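(* Let $u\in C(\mathbb{R}:H^{4,2}(\mathbb{R}))$ be a non-trivial (i.e. not identically zero) real-valued strong solution of the generalized Korteweg-de Vries equation $$\partial_t u+\partial_x(\partial_x^2u+f(u))=0,\qquad (t,x)\in\mathbb{R}\times\mathbb{R}.$$ If $u=u(t,x)$ is periodic in time with period $\omega>0$ (i.e. $u(t+\omega,x)=u(t,x)$ for all $t,x$), then $$\int_0^{\omega}\int_{-\infty}^{\infty}f(u(t,x))\,dx\,dt=0.$$ In particular, if $f$ is one of the following: (i) $f(u)=u^2$; (ii) $f(u)=u^4$; (iii) $f(u)=u^2+\mu u^3+\epsilon^2u^4$ or $f(u)=u^2-\mu u^3+\epsilon^2u^4$, with $0\le\mu<2\epsilon$; then $u$ cannot be a time periodic solution.
   Context: For $s,r\ge 0$, $H^{s,r}(\mathbb{R}):=H^s(\mathbb{R})\cap L^2(|x|^{2r}dx)$. Solutions $u$ are real-valued; "strong solution" of the initial value problem (with $u(0,\cdot)=u_0$) has its standard meaning: $u$ is a continuous function of time with values in the stated space and satisfies the equation with this initial datum. The nonlinearity $f:\mathbb{R}\to\mathbb{R}$ is assumed to be of the form $f(s)=s^k+f_k(s)$ for some integer $k\ge2$, with $f_k:\mathbb{R}\to\mathbb{R}$ of class $C^k$ and $\lim_{s\to0}f_k(s)/|s|^k=0$. *)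

theory Defs
  imports "HOL-Analysis.Analysis"
begin

text \<open>
  Elements of Lebesgue and Sobolev spaces on the line are represented by Borel functions
  \<open>real \<Rightarrow> real\<close>.  The notions defined for
  such elements do not depend on the representative chosen within an almost everywhere class.
\<close>

definition C_class :: "nat \<Rightarrow> (real \<Rightarrow> real) \<Rightarrow> bool" where
  "C_class k g \<longleftrightarrow>
     (\<forall>j<k. \<forall>x. (deriv ^^ j) g differentiable (at x)) \<and> continuous_on UNIV ((deriv ^^ k) g)"

definition test_function :: "(real \<Rightarrow> real) \<Rightarrow> bool" where
  "test_function \<phi> \<longleftrightarrow> (\<forall>k. C_class k \<phi>) \<and> compact (closure {x. \<phi> x \<noteq> 0})"

definition L2 :: "(real \<Rightarrow> real) set" where
  "L2 = {g. g \<in> borel_measurable lborel \<and> integrable lborel (\<lambda>x. (g x)\<^sup>2)}"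

text \<open>Meaningful for elements of \<^const>\<open>L2\<close> only: a divergent integral is 0 by convention.\<close>

definition L2_norm :: "(real \<Rightarrow> real) \<Rightarrow> real" where
  "L2_norm g = sqrt (LINT x|lborel. (g x)\<^sup>2)"

definition locally_integrable :: "(real \<Rightarrow> real) \<Rightarrow> bool" where
  "locally_integrable g \<longleftrightarrow> (\<forall>a b. set_integrable lborel {a..b} g)"

definition has_weak_deriv :: "nat \<Rightarrow> (real \<Rightarrow> real) \<Rightarrow> (real \<Rightarrow> real) \<Rightarrow> bool" where
  "has_weak_deriv n g h \<longleftrightarrow> locally_integrable g \<and> locally_integrable h \<and>
     (\<forall>\<phi>. test_function \<phi> \<longrightarrow>
        (LINT x|lborel. g x * (deriv ^^ n) \<phi> x) = (- 1) ^ n * (LINT x|lborel. h x * \<phi> x))"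

text \<open>Weak derivatives are unique almost everywhere, so the choice below is immaterial.\<close>

definition weak_deriv :: "nat \<Rightarrow> (real \<Rightarrow> real) \<Rightarrow> (real \<Rightarrow> real)" where
  "weak_deriv n g = (SOME h. has_weak_deriv n g h)"

text \<open>The \<open>L\<^sup>2\<close>-based Sobolev space \<open>H\<^sup>m\<close> of integer order \<open>m\<close>.\<close>

definition sobolev :: "nat \<Rightarrow> (real \<Rightarrow> real) set" where
  "sobolev m = {g \<in> L2. \<forall>j\<le>m. \<exists>h\<in>L2. has_weak_deriv j g h}"

text \<open>\<open>H\<^sup>m\<close> intersected with the weighted space \<open>L\<^sup>2(|x|\<^sup>2\<^sup>r dx)\<close>, and its norm.\<close>

definition weighted_sobolev :: "nat \<Rightarrow> real \<Rightarrow> (real \<Rightarrow> real) set" where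
  "weighted_sobolev m r =
     {g \<in> sobolev m. integrable lborel (\<lambda>x. (g x)\<^sup>2 * \<bar>x\<bar> powr (2 * r))}"

definition weighted_sobolev_norm :: "nat \<Rightarrow> real \<Rightarrow> (real \<Rightarrow> real) \<Rightarrow> real" where
  "weighted_sobolev_norm m r g =
     sqrt ((\<Sum>j\<le>m. (L2_norm (weak_deriv j g))\<^sup>2) + (LINT x|lborel. (g x)\<^sup>2 * \<bar>x\<bar> powr (2 * r)))"

text \<open>The class \<open>C(\<real> : H\<^sup>m\<^sup>,\<^sup>r)\<close>.\<close>

definition continuous_in_weighted_sobolev :: "nat \<Rightarrow> real \<Rightarrow> (real \<Rightarrow> real \<Rightarrow> real) \<Rightarrow> bool" where
  "continuous_in_weighted_sobolev m r u \<longleftrightarrow>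
     (\<forall>t. u t \<in> weighted_sobolev m r) \<and>
     (\<forall>t. ((\<lambda>s. weighted_sobolev_norm m r (\<lambda>x. u s x - u t x)) \<longlongrightarrow> 0) (at t))"

text \<open>\<open>v\<close> is the derivative at time \<open>t\<close> of the \<open>L\<^sup>2\<close>-valued map \<open>s \<mapsto> u s\<close>.\<close>

definition has_L2_time_deriv ::
  "(real \<Rightarrow> real \<Rightarrow> real) \<Rightarrow> (real \<Rightarrow> real) \<Rightarrow> real \<Rightarrow> bool" where
  "has_L2_time_deriv u v t \<longleftrightarrow> (\<forall>s. u s \<in> L2) \<and> v \<in> L2 \<and>
     ((\<lambda>h. L2_norm (\<lambda>x. (u (t + h) x - u t x) / h - v x)) \<longlongrightarrow> 0) (at 0)"

text \<open>
  Strong solutions of \<open>\<partial>\<^sub>t u + \<partial>\<^sub>x (\<partial>\<^sub>x\<^sup>2 u + f(u)) = 0\<close> in \<open>C(\<real> : H\<^sup>m\<^sup>,\<^sup>r)\<close>, meant for \<open>m \<ge> 3\<close>: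
  the equation holds at every time as an identity in \<open>L\<^sup>2\<close>, with the time derivative taken
  in \<open>L\<^sup>2\<close> and the space derivatives in the weak sense.
\<close>

definition strong_solution_gKdV ::
  "nat \<Rightarrow> real \<Rightarrow> (real \<Rightarrow> real) \<Rightarrow> (real \<Rightarrow> real \<Rightarrow> real) \<Rightarrow> bool" where
  "strong_solution_gKdV m r f u \<longleftrightarrow> continuous_in_weighted_sobolev m r u \<and>
     (\<forall>t. \<exists>v w. has_L2_time_deriv u v t \<and>
        has_weak_deriv 1 (\<lambda>x. weak_deriv 2 (u t) x + f (u t x)) w \<and>
        (AE x in lborel. v x + w x = 0))"

definition admissible_nonlinearity :: "(real \<Rightarrow> real) \<Rightarrow> bool" where
  "admissible_nonlinearity f \<longleftrightarrow>
     (\<exists>k\<ge>2. \<exists>g. C_class k g \<and> ((\<lambda>s. g s / \<bar>s\<bar> ^ k) \<longlongrightarrow> 0) (at 0) \<and> (\<forall>s. f s = s ^ k + g s))"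

text \<open>
  Being identically zero and being periodic are statements about elements of the function
  space, hence the almost everywhere quantifiers in \<open>x\<close>.
\<close>

definition identically_zero :: "(real \<Rightarrow> real \<Rightarrow> real) \<Rightarrow> bool" where
  "identically_zero u \<longleftrightarrow> (\<forall>t. AE x in lborel. u t x = 0)"

definition time_periodic :: "real \<Rightarrow> (real \<Rightarrow> real \<Rightarrow> real) \<Rightarrow> bool" where
  "time_periodic \<omega> u \<longleftrightarrow> (\<forall>t. AE x in lborel. u (t + \<omega>) x = u t x)"

end

(*
  Pairing the equation with a test function \<phi> gives
    d/dt \<integral> u \<phi> dx = \<integral> u \<phi>''' dx + \<integral> f(u) \<phi>' dx,
  so for an \<omega>-periodic u the right-hand side has zero integral over a period. Take
  \<phi>(x) = \<psi>(s x) / s with \<psi>'(0) nonzero: then \<phi>' tends boundedly to the constant \<psi>'(0) as s tends to 0,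
  while the first term is O(s), since u is bounded in L^2. Near 0 the nonlinearity is
  quadratically small, so the embedding of H^1 into the bounded functions makes f(u) integrable
  and its integral continuous in t, and dominated convergence gives the vanishing of the double
  integral. In the cases (i)-(iii) f is positive off 0, which forces u = 0.
*)
theory Submission
  imports Defs
begin

text \<open>The solution is only an \<open>L2\<close>-valued function of time, so the equation is
  used through pairings with test functions. The weight 1 would require the primitive x, which is
  neither compactly supported nor square integrable; a dilated bump imitates it. The third
  derivative of psi(s x)/s is s^2 psi'''(s x), of L2 norm proportional to s^(3/2), so the growth of
  L2 norms under dilation is harmless. All that is needed about f is one estimate on bounded sets,
  |f a - f b| <= C (|a| + |b|) |a - b|. With b = 0 it makes f(u) integrable; with Cauchy-Schwarz it
  gives continuity in time. It also holds for the square and for |f|, which makes the majorant in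
  the final limit continuous in time. Continuity also upgrades the vanishing time integral of a
  nonnegative quantity to vanishing at every time. As derivatives are weak, the embedding is derived
  from the fundamental lemma of the calculus of variations, with explicit bumps built from
  exp(-1/x).\<close>

section \<open>Test functions\<close>

text \<open>An invariant argument: iterated derivatives never leave a class whose members have
  derivatives in it, so no formula for higher derivatives is needed.\<close>

lemma smoothI:
  assumes "P g" and closed: "\<And>g. P g \<Longrightarrow> \<exists>g'. P g' \<and> (\<forall>x. (g has_real_derivative g' x) (at x))"
  shows "(deriv ^^ j) g differentiable (at x)"
proof -
  have "P ((deriv ^^ j) g)"
  proof (induction j)
    case (Suc j)
    then obtain g' where g': "P g'" "\<And>x. ((deriv ^^ j) g has_real_derivative g' x) (at x)"
      using closed by blast
    then have "deriv ((deriv ^^ j) g) = g'"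
      by (intro ext DERIV_imp_deriv)
    then show ?case using g'(1) by simp
  qed (use assms in simp)
  then show ?thesis
    using closed real_differentiable_def by blast
qed

lemma C_class_all_iff:
  "(\<forall>k. C_class k g) \<longleftrightarrow> (\<forall>j x. (deriv ^^ j) g differentiable (at x))"
proof
  assume "\<forall>k. C_class k g"
  then show "\<forall>j x. (deriv ^^ j) g differentiable (at x)"
    unfolding C_class_def by blast
next
  assume "\<forall>j x. (deriv ^^ j) g differentiable (at x)"
  then show "\<forall>k. C_class k g"
    unfolding C_class_def
    by (auto intro!: continuous_at_imp_continuous_on differentiable_imp_continuous_within)
qed

lemma compact_closure_support_iff:
  fixes g :: "real \<Rightarrow> real"
  shows "compact (closure {x. g x \<noteq> 0}) \<longleftrightarrow> (\<exists>L. \<forall>x. L < \<bar>x\<bar> \<longrightarrow> g x = 0)"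
proof -
  have "compact (closure {x. g x \<noteq> 0}) \<longleftrightarrow> bounded {x. g x \<noteq> 0}"
    by (metis bounded_closure bounded_subset closed_closure closure_subset compact_eq_bounded_closed)
  also have "\<dots> \<longleftrightarrow> (\<exists>L. \<forall>x. L < \<bar>x\<bar> \<longrightarrow> g x = 0)"
    unfolding bounded_iff by (auto simp: not_le[symmetric])
  finally show ?thesis .
qed

lemma test_function_iff:
  "test_function \<phi> \<longleftrightarrow>
     (\<forall>j x. (deriv ^^ j) \<phi> differentiable (at x)) \<and> (\<exists>L. \<forall>x. L < \<bar>x\<bar> \<longrightarrow> \<phi> x = 0)"
  unfolding test_function_def C_class_all_iff compact_closure_support_iff by simp

lemma test_function_support:
  assumes "test_function \<phi>"
  obtains L where "L > 0" "\<And>x. L < \<bar>x\<bar> \<Longrightarrow> \<phi> x = 0"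
proof -
  obtain L where "\<And>x. L < \<bar>x\<bar> \<Longrightarrow> \<phi> x = 0"
    using assms unfolding test_function_iff by blast
  then show thesis
    by (intro that[of "max 1 L"]) auto
qed

lemma test_function_DERIV:
  assumes "test_function \<phi>"
  shows "(\<phi> has_real_derivative deriv \<phi> x) (at x)"
proof -
  have "(deriv ^^ 0) \<phi> differentiable (at x)"
    using assms unfolding test_function_iff by blast
  then show ?thesis
    by (simp add: DERIV_deriv_iff_real_differentiable)
qed

lemma test_function_deriv:
  assumes "test_function \<phi>"
  shows "test_function (deriv \<phi>)"
proof -
  obtain L where L: "\<And>x. L < \<bar>x\<bar> \<Longrightarrow> \<phi> x = 0"
    using test_function_support[OF assms] by metis
  have "deriv \<phi> x = 0" if "L < \<bar>x\<bar>" for x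
  proof -
    have "open {x::real. L < \<bar>x\<bar>}"
      by (intro open_Collect_less continuous_intros)
    then have "(\<phi> has_real_derivative 0) (at x)"
      by (rule has_field_derivative_transform_within_open[where f = "\<lambda>_. 0", rotated])
         (use that L in auto)
    then show ?thesis
      by (rule DERIV_imp_deriv)
  qed
  moreover have "(deriv ^^ j) (deriv \<phi>) differentiable (at x)" for j x
  proof -
    have "(deriv ^^ Suc j) \<phi> differentiable (at x)"
      using assms unfolding test_function_iff by blast
    then show ?thesis
      by (simp add: funpow_swap1)
  qed
  ultimately show ?thesis
    unfolding test_function_iff by blast
qed

lemma test_function_deriv_funpow: "test_function \<phi> \<Longrightarrow> test_function ((deriv ^^ n) \<phi>)"
  by (induction n) (auto intro: test_function_deriv)

lemma test_function_continuous: "test_function \<phi> \<Longrightarrow> continuous_on A \<phi>"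
  by (meson DERIV_isCont continuous_at_imp_continuous_on test_function_DERIV)

lemma test_function_measurable [measurable_dest]: "test_function \<phi> \<Longrightarrow> \<phi> \<in> borel_measurable borel"
  by (rule borel_measurable_continuous_onI) (rule test_function_continuous)

lemma test_function_bounded:
  assumes "test_function \<phi>"
  obtains K where "K > 0" "\<And>x. \<bar>\<phi> x\<bar> \<le> K"
proof -
  obtain L where L: "L > 0" "\<And>x. L < \<bar>x\<bar> \<Longrightarrow> \<phi> x = 0"
    using test_function_support[OF assms] by metis
  have "compact (\<phi> ` {-L..L})"
    by (intro compact_continuous_image test_function_continuous assms) simp
  then obtain K where K: "\<And>x. x \<in> {-L..L} \<Longrightarrow> \<bar>\<phi> x\<bar> \<le> K"
    by (fastforce simp: bounded_iff dest!: compact_imp_bounded)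
  have "\<bar>\<phi> x\<bar> \<le> max 1 K" for x
    using K[of x] L(2)[of x] by (cases "L < \<bar>x\<bar>") (auto simp: max_def abs_le_iff not_less)
  then show thesis
    by (intro that[of "max 1 K"]) auto
qed

lemma test_function_integrable_mult:
  assumes "test_function \<phi>" and "locally_integrable g"
  shows "integrable lborel (\<lambda>x. g x * \<phi> x)"
proof -
  obtain L where L: "\<And>x. L < \<bar>x\<bar> \<Longrightarrow> \<phi> x = 0"
    using test_function_support[OF assms(1)] by metis
  obtain K where K: "K > 0" "\<And>x. \<bar>\<phi> x\<bar> \<le> K"
    using test_function_bounded[OF assms(1)] by metis
  have g: "integrable lborel (\<lambda>x. indicator {-L..L} x * g x)"
    using assms(2) unfolding locally_integrable_def set_integrable_def by simp
  have eq: "g x * \<phi> x = (indicator {-L..L} x * g x) * \<phi> x" for x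
    using L[of x] by (cases "L < \<bar>x\<bar>") (auto simp: indicator_def abs_le_iff not_less)
  have [measurable]: "\<phi> \<in> borel_measurable lborel"
    using test_function_measurable[OF assms(1)] by simp
  have "(\<lambda>x. indicator {-L..L} x * g x) \<in> borel_measurable lborel"
    using g by (rule borel_measurable_integrable)
  then have meas: "(\<lambda>x. (indicator {-L..L} x * g x) * \<phi> x) \<in> borel_measurable lborel"
    by (rule borel_measurable_times) simp
  show ?thesis
    unfolding eq
  proof (rule Bochner_Integration.integrable_bound)
    show "integrable lborel (\<lambda>x. K * (indicator {-L..L} x * g x))"
      using g by simp
    show "AE x in lborel. norm ((indicator {-L..L} x * g x) * \<phi> x)
        \<le> norm (K * (indicator {-L..L} x * g x))"
      using K by (intro AE_I2) (auto simp: abs_mult mult.commute intro!: mult_mono)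
  qed (rule meas)
qed

lemma locally_integrable_const [simp]: "locally_integrable (\<lambda>_. c)"
  unfolding locally_integrable_def
  by (auto intro!: borel_integrable_atLeastAtMost' continuous_intros)

lemma test_function_integrable: "test_function \<phi> \<Longrightarrow> integrable lborel \<phi>"
  using test_function_integrable_mult[of \<phi> "\<lambda>_. 1"] by simp

text \<open>The total integral of \<open>\<rho>\<close> is the only obstruction: it is the value
  that a primitive vanishing left of \<open>a\<close> takes to the right of
  \<open>b\<close>.\<close>

lemma test_function_primitive:
  assumes "test_function \<rho>" and "a \<le> b" and supp: "\<And>x. x \<notin> {a..b} \<Longrightarrow> \<rho> x = 0"
    and zero: "(LINT x|lborel. \<rho> x) = 0"
  obtains \<phi> where "test_function \<phi>" "deriv \<phi> = \<rho>" "\<And>x. x \<notin> {a..b} \<Longrightarrow> \<phi> x = 0"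
proof -
  obtain \<phi> where \<phi>: "\<And>x. (\<phi> has_real_derivative \<rho> x) (at x)" "\<phi> a = 0"
  proof -
    \<comment> \<open>At least one of the two intervals is empty or a single point and contributes
      0, so \<open>F\<close> is the signed integral from \<open>a\<close> on the whole line.\<close>
    define F where "F x = integral {a..x} \<rho> - integral {x..a} \<rho>" for x
    have cont: "continuous_on S \<rho>" for S
      by (rule test_function_continuous[OF assms(1)])
    have "(F has_real_derivative \<rho> x) (at x)" for x
    proof -
      \<comment> \<open>A base point left of both \<open>a\<close> and \<open>x\<close> makes
        \<open>F\<close> differ near \<open>x\<close> from an ordinary indefinite integral by a
        constant only.\<close>
      define c where "c = min a x - 1"
      define d where "d = max a x + 1"
      have int: "\<rho> integrable_on {s..t}" for s t
        using integrable_continuous_interval cont by blast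
      have eq: "integral {c..y} \<rho> - integral {c..a} \<rho> = F y" if "y \<in> {c<..<d}" for y
      proof (cases "a \<le> y")
        case True
        have "integral {c..a} \<rho> + integral {a..y} \<rho> = integral {c..y} \<rho>"
          by (rule Henstock_Kurzweil_Integration.integral_combine) (use True int c_def in auto)
        moreover have "integral {y..a} \<rho> = 0"
          using True by (cases "a = y") auto
        ultimately show ?thesis by (simp add: F_def)
      next
        case False
        have "integral {c..y} \<rho> + integral {y..a} \<rho> = integral {c..a} \<rho>"
          by (rule Henstock_Kurzweil_Integration.integral_combine) (use False int that in auto)
        then show ?thesis using False by (simp add: F_def)
      qed
      have "((\<lambda>y. integral {c..y} \<rho>) has_real_derivative \<rho> x) (at x within {c..d})"
        by (rule integral_has_real_derivative) (auto simp: cont c_def d_def)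
      then have "((\<lambda>y. integral {c..y} \<rho>) has_real_derivative \<rho> x) (at x within {c<..<d})"
        by (rule DERIV_subset) auto
      then have "((\<lambda>y. integral {c..y} \<rho>) has_real_derivative \<rho> x) (at x)"
        by (subst (asm) at_within_open) (auto simp: c_def d_def)
      then have "((\<lambda>y. integral {c..y} \<rho> - integral {c..a} \<rho>) has_real_derivative \<rho> x) (at x)"
        by (auto intro!: derivative_eq_intros)
      then show ?thesis
        by (rule has_field_derivative_transform_within_open[where S = "{c<..<d}"])
           (use eq c_def d_def in auto)
    qed
    then show thesis by (intro that[of F]) (auto simp: F_def)
  qed
  have \<rho>_isCont: "isCont \<rho> x" for x
    using test_function_DERIV[OF assms(1)] DERIV_isCont by blast
  have "(LINT x|lborel. \<rho> x * indicator {a..b} x) = \<phi> b - \<phi> a"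
    by (intro integral_FTC_Icc_real \<phi> \<rho>_isCont assms)
  moreover have "(\<lambda>x. \<rho> x * indicator {a..b} x) = \<rho>"
    using supp by (auto simp: indicator_def fun_eq_iff)
  ultimately have b: "\<phi> b = 0"
    using zero \<phi>(2) by simp
  \<comment> \<open>Between a point outside and the nearer endpoint \<open>\<rho>\<close> vanishes,
    so the mean value theorem carries the value 0 outwards.\<close>
  have out: "\<phi> x = 0" if x: "x \<notin> {a..b}" for x
  proof (cases "x < a")
    case True
    obtain z where "z > x" "z < a" "\<phi> a - \<phi> x = (a - x) * \<rho> z"
      using MVT2[OF True, of \<phi> \<rho>] \<phi> by blast
    then show ?thesis using supp[of z] \<phi> by auto
  next
    case False
    then have "b < x" using x by auto
    obtain z where "z > b" "z < x" "\<phi> x - \<phi> b = (x - b) * \<rho> z"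
      using MVT2[OF \<open>b < x\<close>, of \<phi> \<rho>] \<phi> by blast
    then show ?thesis using supp[of z] b by auto
  qed
  have d: "deriv \<phi> = \<rho>"
    using \<phi> by (intro ext DERIV_imp_deriv)
  have "(deriv ^^ j) \<phi> differentiable (at x)" for j x
  proof (cases j)
    case 0
    then show ?thesis using \<phi>(1) real_differentiable_def by auto
  next
    case (Suc i)
    then have "(deriv ^^ j) \<phi> = (deriv ^^ i) \<rho>"
      using d by (simp add: funpow_swap1)
    then show ?thesis using assms(1) unfolding test_function_iff by simp
  qed
  moreover have "\<exists>L. \<forall>x. L < \<bar>x\<bar> \<longrightarrow> \<phi> x = 0"
    by (rule exI[of _ "max \<bar>a\<bar> \<bar>b\<bar>"]) (auto intro!: out)
  ultimately have "test_function \<phi>"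
    unfolding test_function_iff by blast
  then show thesis using that d out by blast
qed

text \<open>The powers \<open>1 / x ^ n\<close> are what the chain rule produces from \<open>exp (- 1 / x)\<close>.\<close>

inductive exp_class :: "(real \<Rightarrow> real) \<Rightarrow> bool" where
  base: "exp_class (\<lambda>x. if 0 < x then exp (- 1 / x) / x ^ n else 0)"
| const: "exp_class (\<lambda>_. c)"
| add: "exp_class g \<Longrightarrow> exp_class h \<Longrightarrow> exp_class (\<lambda>x. g x + h x)"
| mult: "exp_class g \<Longrightarrow> exp_class h \<Longrightarrow> exp_class (\<lambda>x. g x * h x)"
| affine: "exp_class g \<Longrightarrow> exp_class (\<lambda>x. g (a + s * x))"

text \<open>Under the substitution y = 1/h this is y^n / exp y -> 0 at infinity.\<close>

lemma exp_minus_inverse_flat: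
  "((\<lambda>h::real. exp (- 1 / h) / h ^ n) \<longlongrightarrow> 0) (at_right 0)"
proof -
  have "((\<lambda>y::real. y ^ n / exp y) \<longlongrightarrow> 0) at_top"
    by (rule tendsto_power_div_exp_0)
  then have "((\<lambda>h::real. inverse h ^ n / exp (inverse h)) \<longlongrightarrow> 0) (at_right 0)"
    by (rule filterlim_compose[OF _ filterlim_inverse_at_top_right])
  moreover have "inverse h ^ n / exp (inverse h) = exp (- 1 / h) / h ^ n" for h :: real
    by (simp add: exp_minus field_simps power_inverse)
  ultimately show ?thesis by simp
qed

lemma exp_class_base_DERIV:
  defines "b \<equiv> \<lambda>n x::real. if 0 < x then exp (- 1 / x) / x ^ n else 0"
  shows "(b n has_real_derivative b (n + 2) x + (- real n) * b (n + 1) x) (at x)"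
proof -
  consider "x > 0" | "x < 0" | "x = 0" by linarith
  then show ?thesis
  proof cases
    case 1
    \<comment> \<open>The form n x^n / x avoids the truncated exponent \<open>n - 1\<close> at
      \<open>n = 0\<close>.\<close>
    have p: "((\<lambda>x. x ^ n) has_real_derivative real n * x ^ n / x) (at x)"
      using DERIV_pow[of n x UNIV] 1 by (cases n) auto
    have "((\<lambda>x. exp (- 1 / x) / x ^ n) has_real_derivative b (n + 2) x + (- real n) * b (n + 1) x) (at x)"
      unfolding b_def
    proof (rule DERIV_cong[OF DERIV_divide[OF _ p]])
      show "((\<lambda>x. exp (- 1 / x)) has_real_derivative exp (- 1 / x) / x ^ 2) (at x)"
        using 1 by (auto intro!: derivative_eq_intros simp: power2_eq_square)
    qed (use 1 in \<open>auto simp: field_simps power2_eq_square\<close>)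
    then show ?thesis
      by (rule has_field_derivative_transform_within_open[where S = "{0<..}"])
         (use 1 in \<open>auto simp: b_def\<close>)
  next
    case 2
    have "((\<lambda>x. 0) has_real_derivative b (n + 2) x + (- real n) * b (n + 1) x) (at x)"
      using 2 by (simp add: b_def)
    then show ?thesis
      by (rule has_field_derivative_transform_within_open[where S = "{..<0}"])
         (use 2 in \<open>auto simp: b_def\<close>)
  next
    case 3
    \<comment> \<open>The right difference quotient is exp(-1/h) / h^(n+1), one power more than in
      \<open>b n\<close>; the left one is identically 0.\<close>
    have "((\<lambda>h. (b n (0 + h) - b n 0) / h) \<longlongrightarrow> 0) (at_right 0)"
    proof (rule Lim_transform_eventually[OF exp_minus_inverse_flat[of "Suc n"]])
      show "\<forall>\<^sub>F h in at_right 0. exp (- 1 / h) / h ^ Suc n = (b n (0 + h) - b n 0) / h"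
        unfolding eventually_at_right_field by (intro exI[of _ 1]) (auto simp: b_def)
    qed
    moreover have "((\<lambda>h. (b n (0 + h) - b n 0) / h) \<longlongrightarrow> 0) (at_left 0)"
    proof (rule Lim_transform_eventually[OF tendsto_const[of 0]])
      show "\<forall>\<^sub>F h in at_left 0. 0 = (b n (0 + h) - b n 0) / h"
        unfolding eventually_at_left_field by (intro exI[of _ "-1"]) (auto simp: b_def)
    qed
    ultimately have "((\<lambda>h. (b n (0 + h) - b n 0) / h) \<longlongrightarrow> 0) (at 0)"
      using filterlim_split_at by blast
    then have "(b n has_real_derivative 0) (at 0)"
      unfolding DERIV_def .
    then show ?thesis using 3 by (simp add: b_def)
  qed
qed

text \<open>The closure hypothesis of \<open>smoothI\<close>; the generating rules of the class
  match the sum, product and chain rules.\<close>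

lemma exp_class_DERIV:
  assumes "exp_class g"
  shows "\<exists>g'. exp_class g' \<and> (\<forall>x. (g has_real_derivative g' x) (at x))"
  using assms
proof induction
  case (base n)
  show ?case
    by (rule exI, rule conjI[rotated], rule allI, rule exp_class_base_DERIV)
       (intro exp_class.add exp_class.mult exp_class.const exp_class.base)
next
  case (const c)
  show ?case by (intro exI[of _ "\<lambda>_. 0"]) (auto intro: exp_class.const)
next
  case (add g h)
  then obtain g' h' where "exp_class g'" "exp_class h'"
    "\<And>x. (g has_real_derivative g' x) (at x)" "\<And>x. (h has_real_derivative h' x) (at x)"
    by blast
  then show ?case
    by (intro exI[of _ "\<lambda>x. g' x + h' x"]) (auto intro: exp_class.add DERIV_add)
next
  case (mult g h)
  then obtain g' h' where "exp_class g'" "exp_class h'"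
    "\<And>x. (g has_real_derivative g' x) (at x)" "\<And>x. (h has_real_derivative h' x) (at x)"
    by blast
  with mult.hyps show ?case
    by (intro exI[of _ "\<lambda>x. g' x * h x + h' x * g x"])
       (auto intro: exp_class.add exp_class.mult DERIV_mult)
next
  case (affine g a s)
  then obtain g' where g': "exp_class g'" "\<And>x. (g has_real_derivative g' x) (at x)"
    by blast
  have "((\<lambda>x. g (a + s * x)) has_real_derivative g' (a + s * x) * s) (at x)" for x
    by (rule DERIV_chain2[OF g'(2)]) (auto intro!: derivative_eq_intros)
  with g'(1) show ?case
    by (intro exI[of _ "\<lambda>x. g' (a + s * x) * s"])
       (auto intro: exp_class.mult exp_class.const exp_class.affine)
qed

lemma exp_class_test_function:
  assumes "exp_class g" and "\<And>x. L < \<bar>x\<bar> \<Longrightarrow> g x = 0"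
  shows "test_function g"
  using assms smoothI[of exp_class, OF _ exp_class_DERIV] unfolding test_function_iff by blast

section \<open>Linear combinations and dilations of test functions\<close>

lemma test_function_mult_const:
  assumes "test_function \<phi>"
  shows "test_function (\<lambda>x. c * \<phi> x)"
proof -
  have D: "((\<lambda>x. c * (deriv ^^ j) \<phi> x) has_real_derivative c * (deriv ^^ Suc j) \<phi> x) (at x)" for j x
    using test_function_DERIV[OF test_function_deriv_funpow[OF assms]]
    by (auto intro!: derivative_eq_intros)
  have "(deriv ^^ j) (\<lambda>x. c * \<phi> x) = (\<lambda>x. c * (deriv ^^ j) \<phi> x)" for j
  proof (induction j)
    case (Suc j)
    have "deriv (\<lambda>x. c * (deriv ^^ j) \<phi> x) = (\<lambda>x. c * (deriv ^^ Suc j) \<phi> x)"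
      by (intro ext DERIV_imp_deriv D)
    then show ?case using Suc by simp
  qed simp
  then have "\<forall>j x. (deriv ^^ j) (\<lambda>x. c * \<phi> x) differentiable (at x)"
    using D real_differentiable_def by (metis (no_types, lifting))
  moreover obtain L where "\<And>x. L < \<bar>x\<bar> \<Longrightarrow> \<phi> x = 0"
    using test_function_support assms by metis
  then have "\<forall>x. L < \<bar>x\<bar> \<longrightarrow> c * \<phi> x = 0" by auto
  ultimately show ?thesis unfolding test_function_iff by blast
qed

lemma test_function_diff:
  assumes "test_function \<phi>" "test_function \<psi>"
  shows "test_function (\<lambda>x. \<phi> x - \<psi> x)"
proof -
  have D: "((\<lambda>x. (deriv ^^ j) \<phi> x - (deriv ^^ j) \<psi> x) has_real_derivative
      (deriv ^^ Suc j) \<phi> x - (deriv ^^ Suc j) \<psi> x) (at x)" for j x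
    using test_function_DERIV[OF test_function_deriv_funpow[OF assms(1)]]
      test_function_DERIV[OF test_function_deriv_funpow[OF assms(2)]]
    by (auto intro!: derivative_eq_intros)
  have "(deriv ^^ j) (\<lambda>x. \<phi> x - \<psi> x) = (\<lambda>x. (deriv ^^ j) \<phi> x - (deriv ^^ j) \<psi> x)" for j
  proof (induction j)
    case (Suc j)
    have "deriv (\<lambda>x. (deriv ^^ j) \<phi> x - (deriv ^^ j) \<psi> x) = (\<lambda>x. (deriv ^^ Suc j) \<phi> x - (deriv ^^ Suc j) \<psi> x)"
      by (intro ext DERIV_imp_deriv D)
    then show ?case using Suc by simp
  qed simp
  then have "\<forall>j x. (deriv ^^ j) (\<lambda>x. \<phi> x - \<psi> x) differentiable (at x)"
    using D real_differentiable_def by (metis (no_types, lifting))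
  moreover obtain L M where "\<And>x. L < \<bar>x\<bar> \<Longrightarrow> \<phi> x = 0" "\<And>x. M < \<bar>x\<bar> \<Longrightarrow> \<psi> x = 0"
    using test_function_support assms by metis
  then have "\<forall>x. max L M < \<bar>x\<bar> \<longrightarrow> \<phi> x - \<psi> x = 0" by auto
  ultimately show ?thesis unfolding test_function_iff by blast
qed

lemma test_function_scale:
  assumes "test_function \<phi>" "s \<noteq> 0"
  shows "test_function (\<lambda>x. \<phi> (s * x))" "(deriv ^^ j) (\<lambda>x. \<phi> (s * x)) = (\<lambda>x. s ^ j * (deriv ^^ j) \<phi> (s * x))"
proof -
  have D: "((\<lambda>x. s ^ j * (deriv ^^ j) \<phi> (s * x)) has_real_derivative
       s ^ Suc j * (deriv ^^ Suc j) \<phi> (s * x)) (at x)" for j x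
  proof -
    have "((\<lambda>x. (deriv ^^ j) \<phi> (s * x)) has_real_derivative (deriv ^^ Suc j) \<phi> (s * x) * s) (at x)"
      using test_function_DERIV[OF test_function_deriv_funpow[OF assms(1)]]
      by (intro DERIV_chain2[where g = "\<lambda>x. s * x"]) (auto intro!: derivative_eq_intros)
    from DERIV_cmult[OF this, of "s ^ j"] show ?thesis by (simp add: mult_ac)
  qed
  show eq: "(deriv ^^ j) (\<lambda>x. \<phi> (s * x)) = (\<lambda>x. s ^ j * (deriv ^^ j) \<phi> (s * x))" for j
  proof (induction j)
    case (Suc j)
    have "deriv (\<lambda>x. s ^ j * (deriv ^^ j) \<phi> (s * x)) = (\<lambda>x. s ^ Suc j * (deriv ^^ Suc j) \<phi> (s * x))"
      by (intro ext DERIV_imp_deriv D)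
    then show ?case using Suc by simp
  qed simp
  obtain L where L: "\<And>x. L < \<bar>x\<bar> \<Longrightarrow> \<phi> x = 0"
    using test_function_support[OF assms(1)] by metis
  have "\<forall>x. L / \<bar>s\<bar> < \<bar>x\<bar> \<longrightarrow> \<phi> (s * x) = 0"
    using L assms(2) by (auto simp: divide_less_eq abs_mult mult.commute)
  then show "test_function (\<lambda>x. \<phi> (s * x))"
    unfolding test_function_iff eq using D real_differentiable_def by blast
qed

section \<open>Concrete bumps\<close>

text \<open>With e(x) = exp(-1/x) for x > 0 and 0 otherwise, the product e((n+1)(x-a)) e((n+1)(b-x))
  vanishes off the interval, while inside it both exponents are of order 1/(n+1), so the values tend
  to 1.\<close>

lemma indicator_Ioo_test_approx:
  fixes a b :: real
  obtains \<phi> :: "nat \<Rightarrow> real \<Rightarrow> real" where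
    "\<And>n. test_function (\<phi> n)" "\<And>n x. 0 \<le> \<phi> n x" "\<And>n x. \<phi> n x \<le> 1"
    "\<And>n x. x \<notin> {a<..<b} \<Longrightarrow> \<phi> n x = 0"
    "\<And>x. (\<lambda>n. \<phi> n x) \<longlonglongrightarrow> indicator {a<..<b} x"
proof -
  define e :: "real \<Rightarrow> real" where "e x = (if 0 < x then exp (- 1 / x) / x ^ 0 else 0)" for x
  have e: "0 \<le> e x" "e x \<le> 1" "x \<le> 0 \<Longrightarrow> e x = 0" "0 < x \<Longrightarrow> e x = exp (- (1 / x))" for x
    by (auto simp: e_def)
  have exp_e: "exp_class e"
    using exp_class.base[of 0] by (simp add: e_def[abs_def])
  \<comment> \<open>The arguments (n+1)(x-a) and (n+1)(b-x) are spelled in the shape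
    \<open>a + s * x\<close> that \<open>exp_class.affine\<close> expects.\<close>
  define \<phi> :: "nat \<Rightarrow> real \<Rightarrow> real" where "\<phi> n x = e (- a * real (Suc n) + real (Suc n) * x) * e (b * real (Suc n) + (- real (Suc n)) * x)" for n x
  have pos: "- a * real (Suc n) + real (Suc n) * x \<le> 0 \<longleftrightarrow> x \<le> a" "b * real (Suc n) + (- real (Suc n)) * x \<le> 0 \<longleftrightarrow> b \<le> x"
    for n x
  proof -
    have "- a * real (Suc n) + real (Suc n) * x = real (Suc n) * (x - a)" "b * real (Suc n) + (- real (Suc n)) * x = real (Suc n) * (b - x)"
      by (auto simp: algebra_simps)
    then show "- a * real (Suc n) + real (Suc n) * x \<le> 0 \<longleftrightarrow> x \<le> a" "b * real (Suc n) + (- real (Suc n)) * x \<le> 0 \<longleftrightarrow> b \<le> x"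
      by (auto simp: mult_le_0_iff)
  qed
  have out: "\<phi> n x = 0" if "x \<notin> {a<..<b}" for n x
    using that e(3) pos[of n x] unfolding \<phi>_def by auto
  show thesis
  proof (rule that[of \<phi>])
    fix n
    have "exp_class (\<phi> n)"
      unfolding \<phi>_def[abs_def] by (intro exp_class.mult exp_class.affine exp_e)
    then show "test_function (\<phi> n)"
      by (rule exp_class_test_function[where L = "max \<bar>a\<bar> \<bar>b\<bar>"]) (rule out, auto)
    show "0 \<le> \<phi> n x" "\<phi> n x \<le> 1" for x
      using e by (auto simp: \<phi>_def intro!: mult_le_one)
    show "\<phi> n x = 0" if "x \<notin> {a<..<b}" for x
      using out that .
  next
    fix x
    show "(\<lambda>n. \<phi> n x) \<longlonglongrightarrow> indicator {a<..<b} x"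
    proof (cases "x \<in> {a<..<b}")
      case True
      have eq: "\<phi> n x = exp (- ((1 / (x - a)) / real (Suc n))) * exp (- ((1 / (b - x)) / real (Suc n)))" for n
      proof -
        have "- a * real (Suc n) + real (Suc n) * x = real (Suc n) * (x - a)" "b * real (Suc n) + (- real (Suc n)) * x = real (Suc n) * (b - x)"
          by (auto simp: algebra_simps)
        with True show ?thesis
          unfolding \<phi>_def by (simp add: e(4) del: of_nat_Suc) (simp add: mult.commute)
      qed
      have lim: "(\<lambda>n. c / real (Suc n)) \<longlonglongrightarrow> 0" for c
        by (rule LIMSEQ_Suc) (rule lim_const_over_n)
      have "(\<lambda>n. exp (- ((1 / (x - a)) / real (Suc n))) * exp (- ((1 / (b - x)) / real (Suc n))))
         \<longlonglongrightarrow> exp (- 0) * exp (- 0)"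
        by (intro tendsto_intros lim)
      then show ?thesis using True eq by simp
    next
      case False
      then show ?thesis using out by (auto simp: indicator_def)
    qed
  qed
qed

text \<open>A nonzero bump is not constant, so its slope is nonzero somewhere; a translation moves
  that point to 0.\<close>

lemma ex_test_function_deriv_nonzero:
  obtains \<psi> where "test_function \<psi>" "deriv \<psi> 0 \<noteq> 0"
proof -
  define e :: "real \<Rightarrow> real" where "e x = (if 0 < x then exp (- 1 / x) / x ^ 0 else 0)" for x
  have exp_e: "exp_class e"
    using exp_class.base[of 0] by (simp add: e_def[abs_def])
  \<comment> \<open>\<open>b c\<close> is the bump e(y) e(1 - y) evaluated at y = c + x.\<close>
  define b where "b c x = e (c + 1 * x) * e ((1 - c) + (- 1) * x)" for c x
  have b0: "b c x = b 0 (c + x)" for c x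
    by (simp add: b_def algebra_simps)
  have test: "test_function (b c)" for c
    by (rule exp_class_test_function[where L = "1 + \<bar>c\<bar>"])
       (auto simp only: b_def[abs_def] intro!: exp_class.mult exp_class.affine exp_e,
        auto simp: e_def)
  have "\<exists>c. deriv (b 0) c \<noteq> 0"
  proof (rule ccontr)
    assume "\<not> ?thesis"
    then have "(b 0 has_real_derivative 0) (at x)" for x
      using test_function_DERIV[OF test, of 0 x] by simp
    then have "b 0 (1/2) = b 0 0"
      using DERIV_isconst_all by blast
    then show False by (simp add: b_def e_def)
  qed
  then obtain c where c: "deriv (b 0) c \<noteq> 0" by blast
  have "(b c has_real_derivative deriv (b 0) c) (at 0)"
  proof -
    have "((\<lambda>x. b 0 (c + x)) has_real_derivative deriv (b 0) c * 1) (at 0)"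
      by (rule DERIV_chain2) (auto intro!: derivative_eq_intros test_function_DERIV test)
    then show ?thesis by (subst ext[OF b0]) simp
  qed
  then have "deriv (b c) 0 \<noteq> 0"
    using c by (simp add: DERIV_imp_deriv)
  then show thesis using that test by blast
qed

section \<open>Square integrable functions\<close>

lemma L2_measurable [measurable_dest]: "g \<in> L2 \<Longrightarrow> g \<in> borel_measurable borel"
  and L2_integrable_square: "g \<in> L2 \<Longrightarrow> integrable lborel (\<lambda>x. (g x)\<^sup>2)"
  unfolding L2_def by auto

lemma L2_norm_power2: "(L2_norm g)\<^sup>2 = (LINT x|lborel. (g x)\<^sup>2)"
  unfolding L2_norm_def by simp

lemma L2_norm_nonneg [simp]: "0 \<le> L2_norm g"
  unfolding L2_norm_def by simp

lemma L2I_bound: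
  assumes "integrable lborel k" "g \<in> borel_measurable borel" "\<And>x. (g x)\<^sup>2 \<le> k x"
  shows "g \<in> L2"
  unfolding L2_def
proof (intro CollectI conjI)
  have "(\<lambda>x. (g x)\<^sup>2) \<in> borel_measurable lborel"
    using assms(2) by measurable
  then show "integrable lborel (\<lambda>x. (g x)\<^sup>2)"
    by (rule Bochner_Integration.integrable_bound[OF assms(1)])
       (auto intro!: AE_I2 order_trans[OF assms(3)])
qed (use assms in simp)

lemma square_add_le: "((a::real) + b)\<^sup>2 \<le> 2 * a\<^sup>2 + 2 * b\<^sup>2"
  using zero_le_power2[of "a - b"] by (simp add: power2_eq_square algebra_simps)

lemma square_diff_le: "((a::real) - b)\<^sup>2 \<le> 2 * a\<^sup>2 + 2 * b\<^sup>2"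
  using square_add_le[of a "- b"] by simp

lemma L2_scale: "g \<in> L2 \<Longrightarrow> (\<lambda>x. c * g x) \<in> L2"
  unfolding L2_def by (auto simp: power_mult_distrib)

lemma L2_abs: "g \<in> L2 \<Longrightarrow> (\<lambda>x. \<bar>g x\<bar>) \<in> L2"
  unfolding L2_def by auto

lemma L2_add: "g \<in> L2 \<Longrightarrow> h \<in> L2 \<Longrightarrow> (\<lambda>x. g x + h x) \<in> L2"
  by (rule L2I_bound[where k = "\<lambda>x. 2 * (g x)\<^sup>2 + 2 * (h x)\<^sup>2"])
     (auto simp: L2_integrable_square L2_measurable square_add_le)

lemma L2_diff: "g \<in> L2 \<Longrightarrow> h \<in> L2 \<Longrightarrow> (\<lambda>x. g x - h x) \<in> L2"
  by (rule L2I_bound[where k = "\<lambda>x. 2 * (g x)\<^sup>2 + 2 * (h x)\<^sup>2"])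
     (auto simp: L2_integrable_square L2_measurable square_diff_le)

lemma L2_integrable_mult:
  assumes "g \<in> L2" "h \<in> L2"
  shows "integrable lborel (\<lambda>x. g x * h x)"
proof (rule Bochner_Integration.integrable_bound)
  show "integrable lborel (\<lambda>x. (g x)\<^sup>2 + (h x)\<^sup>2)"
    using assms by (simp add: L2_integrable_square)
  show "(\<lambda>x. g x * h x) \<in> borel_measurable lborel"
    using assms[THEN L2_measurable] by simp
  have "\<bar>a * b\<bar> \<le> a\<^sup>2 + b\<^sup>2" for a b :: real
  proof -
    have "2 * \<bar>a\<bar> * \<bar>b\<bar> \<le> \<bar>a\<bar>\<^sup>2 + \<bar>b\<bar>\<^sup>2"
      by (rule sum_squares_bound)
    moreover have "0 \<le> \<bar>a\<bar> * \<bar>b\<bar>" by simp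
    ultimately show ?thesis unfolding abs_mult power2_abs by linarith
  qed
  then show "AE x in lborel. norm (g x * h x) \<le> norm ((g x)\<^sup>2 + (h x)\<^sup>2)"
    by (intro AE_I2) simp
qed

text \<open>The discriminant argument: the integral of (g + t h)^2 is a nonnegative polynomial in
  t.\<close>

lemma L2_Cauchy_Schwarz:
  assumes "g \<in> L2" "h \<in> L2"
  shows "\<bar>LINT x|lborel. g x * h x\<bar> \<le> L2_norm g * L2_norm h"
proof -
  define A B C where "A = (LINT x|lborel. (g x)\<^sup>2)" and "B = (LINT x|lborel. g x * h x)"
    and "C = (LINT x|lborel. (h x)\<^sup>2)"
  have q: "0 \<le> A + 2 * t * B + t\<^sup>2 * C" for t
  proof -
    have "0 \<le> (LINT x|lborel. (g x + t * h x)\<^sup>2)" by simp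
    also have "(\<lambda>x. (g x + t * h x)\<^sup>2) = (\<lambda>x. (g x)\<^sup>2 + 2 * t * (g x * h x) + t\<^sup>2 * (h x)\<^sup>2)"
      by (auto simp: power2_eq_square algebra_simps)
    also have "(LINT x|lborel. (g x)\<^sup>2 + 2 * t * (g x * h x) + t\<^sup>2 * (h x)\<^sup>2) = A + 2 * t * B + t\<^sup>2 * C"
      unfolding A_def B_def C_def
      using assms L2_integrable_mult[OF assms] by (simp add: L2_integrable_square)
    finally show ?thesis .
  qed
  have C: "0 \<le> C" by (simp add: C_def)
  have "B\<^sup>2 \<le> A * C"
  proof (cases "C = 0")
    case True
    have "B = 0"
    proof (rule ccontr)
      assume "B \<noteq> 0"
      \<comment> \<open>With \<open>C = 0\<close> the polynomial is affine, and this
        \<open>t\<close> gives it the value -1.\<close>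
      then show False using q[of "- (A + 1) / (2 * B)"] True by (simp add: field_simps)
    qed
    then show ?thesis using True by simp
  next
    case False
    then have "0 < C" using C by simp
    \<comment> \<open>The value t = -B/C minimises the polynomial.\<close>
    then show ?thesis
      using q[of "- B / C"] by (simp add: field_simps power2_eq_square)
  qed
  then have "sqrt (B\<^sup>2) \<le> sqrt (A * C)" by (rule real_sqrt_le_mono)
  then show ?thesis
    unfolding L2_norm_def A_def B_def C_def by (simp add: real_sqrt_mult)
qed

lemma integrable_indicator_Icc: "integrable lborel (indicator {a..b} :: real \<Rightarrow> real)"
  by (rule integrable_real_indicator) (auto simp: emeasure_lborel_Icc_eq)

lemma L2_indicator: "(indicator {a..b} :: real \<Rightarrow> real) \<in> L2"
  by (rule L2I_bound[where k = "indicator {a..b}"]) (auto simp: indicator_def integrable_indicator_Icc)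

lemma L2_locally_integrable: "g \<in> L2 \<Longrightarrow> locally_integrable g"
  unfolding locally_integrable_def set_integrable_def
  using L2_integrable_mult[OF L2_indicator] by simp

text \<open>Local integrability gives measurability of truncations only; \<open>g\<close> is their
  pointwise limit.\<close>

lemma locally_integrable_measurable:
  assumes "locally_integrable g"
  shows "g \<in> borel_measurable borel"
proof (rule borel_measurable_LIMSEQ_real)
  fix x :: real
  show "(\<lambda>n. indicator {- real n..real n} x * g x) \<longlonglongrightarrow> g x"
  proof (rule tendsto_eventually)
    obtain N where "\<bar>x\<bar> < real N" using reals_Archimedean2 by blast
    then show "\<forall>\<^sub>F n in sequentially. indicator {- real n..real n} x * g x = g x"
      by (intro eventually_sequentiallyI[of N]) (auto simp: indicator_def)
  qed
next
  fix n
  have "integrable lborel (\<lambda>x. indicator {- real n..real n} x * g x)"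
    using assms unfolding locally_integrable_def set_integrable_def by simp
  from borel_measurable_integrable[OF this]
  show "(\<lambda>x. indicator {- real n..real n} x * g x) \<in> borel_measurable borel"
    by simp
qed

lemma locally_integrable_diff:
  "locally_integrable g \<Longrightarrow> locally_integrable h \<Longrightarrow> locally_integrable (\<lambda>x. g x - h x)"
  unfolding locally_integrable_def by (auto intro: set_integral_diff)

lemma locally_integrable_bounded:
  assumes "g \<in> borel_measurable borel" "\<And>x. \<bar>g x\<bar> \<le> K"
  shows "locally_integrable g"
  unfolding locally_integrable_def set_integrable_def
proof (intro allI)
  fix a b :: real
  have "integrable lborel (\<lambda>x. K * indicator {a..b} x)" by (simp add: integrable_indicator_Icc)
  moreover have "(\<lambda>x. indicator {a..b} x *\<^sub>R g x) \<in> borel_measurable lborel"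
    using assms(1) by measurable
  ultimately show "integrable lborel (\<lambda>x. indicator {a..b} x *\<^sub>R g x)"
    by (rule Bochner_Integration.integrable_bound)
       (auto simp: indicator_def intro!: AE_I2 order_trans[OF assms(2)])
qed

section \<open>Uniqueness of weak derivatives\<close>

lemma borel_eq_Ioo: "borel = sigma UNIV (range (\<lambda>(a, b). {a<..<b::real}))"
  using borel_eq_box[where 'a = real] by (simp add: box_real)

text \<open>Dynkin's pi-lambda theorem: open intervals generate the Borel sets and are stable under
  intersection, so \<open>w\<close> integrates to 0 over every Borel set and
  \<open>density_zero\<close> applies.\<close>

lemma AE_zero_if_interval_integrals_zero:
  fixes w :: "real \<Rightarrow> real"
  assumes w: "integrable lborel w"
    and zero: "\<And>a b. (LINT x:{a<..<b}|lborel. w x) = 0"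
  shows "AE x in lborel. w x = 0"
proof (rule sigma_finite_measure.density_zero[OF sigma_finite_lborel w])
  have ind: "integrable lborel (\<lambda>x. indicator A x *\<^sub>R w x)" if "A \<in> sets borel" for A
    using that w by (intro integrable_mult_indicator) auto
  \<comment> \<open>The intervals are bounded, so the integral over the line is obtained as a limit;
    the complement case of the induction subtracts from it.\<close>
  have total: "(LINT x|lborel. w x) = 0"
  proof -
    have "(\<lambda>n. LINT x|lborel. indicator {- real n<..<real n} x *\<^sub>R w x) \<longlonglongrightarrow> (LINT x|lborel. w x)"
    proof (rule integral_dominated_convergence)
      show "integrable lborel (\<lambda>x. \<bar>w x\<bar>)" using w by simp
      show "w \<in> borel_measurable lborel" using w by simp
      show "(\<lambda>x. indicator {- real n<..<real n} x *\<^sub>R w x) \<in> borel_measurable lborel" for n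
        using ind by (intro borel_measurable_integrable) auto
      show "AE x in lborel. (\<lambda>n. indicator {- real n<..<real n} x *\<^sub>R w x) \<longlonglongrightarrow> w x"
      proof (intro AE_I2 tendsto_eventually)
        fix x :: real
        obtain N where "\<bar>x\<bar> < real N" using reals_Archimedean2 by blast
        then show "\<forall>\<^sub>F n in sequentially. indicator {- real n<..<real n} x *\<^sub>R w x = w x"
          by (intro eventually_sequentiallyI[of N]) (auto simp: indicator_def)
      qed
    qed (auto simp: indicator_def)
    moreover have "(LINT x|lborel. indicator {- real n<..<real n} x *\<^sub>R w x) = 0" for n
      using zero unfolding set_lebesgue_integral_def .
    ultimately show ?thesis by (simp only: LIMSEQ_const_iff)
  qed
  fix A :: "real set"
  assume "A \<in> sets lborel"
  then have A: "A \<in> sigma_sets UNIV (range (\<lambda>(a, b). {a<..<b}))"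
    by (simp add: borel_eq_Ioo)
  have "Int_stable (range (\<lambda>(a, b). {a<..<b::real}))"
  proof (rule Int_stableI)
    fix S T assume "S \<in> range (\<lambda>(a, b). {a<..<b::real})" "T \<in> range (\<lambda>(a, b). {a<..<b::real})"
    then obtain a b c d where "S = {a<..<b}" "T = {c<..<d}" by auto
    then have "S \<inter> T = (\<lambda>(a, b). {a<..<b}) (max a c, min b d)" by auto
    then show "S \<inter> T \<in> range (\<lambda>(a, b). {a<..<b::real})" by blast
  qed
  moreover have "range (\<lambda>(a, b). {a<..<b::real}) \<subseteq> Pow UNIV" by simp
  ultimately show "(LINT x:A|lborel. w x) = 0"
    using A
  proof (induction rule: sigma_sets_induct_disjoint)
    case (basic A)
    then show ?case using zero by auto
  next
    case empty
    then show ?case by (simp add: set_lebesgue_integral_def)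
  next
    case (compl A)
    then have [measurable]: "A \<in> sets borel" by (simp add: borel_eq_Ioo)
    have eq: "(\<lambda>x. indicator (UNIV - A) x *\<^sub>R w x) = (\<lambda>x. w x - indicator A x *\<^sub>R w x)"
      by (auto simp: indicator_def)
    show ?case
      using compl w ind[of A] total unfolding set_lebesgue_integral_def eq by simp
  next
    case (union A)
    then have [measurable]: "A i \<in> sets borel" for i by (auto simp: borel_eq_Ioo)
    have "(LINT x:(\<Union>i. A i)|lborel. w x) = (\<Sum>i. LINT x:A i|lborel. w x)"
    proof (rule lebesgue_integral_countable_add)
      show "A i \<inter> A j = {}" if "i \<noteq> j" for i j
        using union(1) that by (auto simp: disjoint_family_on_def)
    qed (use ind in \<open>auto simp: set_integrable_def\<close>)
    then show ?case using union by simp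
  qed
qed

text \<open>A local form of the fundamental lemma of the calculus of variations:
  \<open>weak_deriv_primitive\<close> controls only test functions supported in a bounded
  window.\<close>

lemma AE_zero_on_Ioo_if_test_integrals_zero:
  fixes w :: "real \<Rightarrow> real"
  assumes w: "set_integrable lborel {a..b} w"
    and zero: "\<And>\<phi>. test_function \<phi> \<Longrightarrow> (\<And>x. x \<notin> {a<..<b} \<Longrightarrow> \<phi> x = 0) \<Longrightarrow>
      (LINT x|lborel. w x * \<phi> x) = 0"
  shows "AE x in lborel. x \<in> {a<..<b} \<longrightarrow> w x = 0"
proof -
  define W where "W x = indicator {a<..<b} x * w x" for x
  have W: "integrable lborel W"
    using set_integrable_subset[OF w, of "{a<..<b}"] unfolding set_integrable_def W_def
    by (simp add: subset_iff less_imp_le)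
  have "AE x in lborel. W x = 0"
  proof (rule AE_zero_if_interval_integrals_zero[OF W])
    fix c d :: real
    \<comment> \<open>Intersecting with (a, b) keeps the approximating functions among those covered
      by \<open>zero\<close>; since \<open>W\<close> vanishes off (a, b), its integral over (c, d)
      is unchanged.\<close>
    define I where "I = {max a c<..<min b d}"
    obtain \<phi> where \<phi>: "\<And>n. test_function (\<phi> n)" "\<And>n x. 0 \<le> \<phi> n x" "\<And>n x. \<phi> n x \<le> 1"
      "\<And>n x. x \<notin> I \<Longrightarrow> \<phi> n x = 0" "\<And>x. (\<lambda>n::nat. \<phi> n x) \<longlonglongrightarrow> indicator I x"
      unfolding I_def by (rule indicator_Ioo_test_approx[of "max a c" "min b d"]) blast
    have [measurable]: "\<phi> n \<in> borel_measurable borel" "W \<in> borel_measurable borel" for n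
      using test_function_measurable[OF \<phi>(1)] W by auto
    have "(\<lambda>n. LINT x|lborel. W x * \<phi> n x) \<longlonglongrightarrow> (LINT x|lborel. W x * indicator I x)"
    proof (rule integral_dominated_convergence)
      show "integrable lborel (\<lambda>x. \<bar>W x\<bar>)" using W by simp
      show "AE x in lborel. norm (W x * \<phi> n x) \<le> \<bar>W x\<bar>" for n
        using \<phi>(2,3) by (auto simp: abs_mult intro!: mult_left_le)
      show "AE x in lborel. (\<lambda>n. W x * \<phi> n x) \<longlonglongrightarrow> W x * indicator I x"
        by (intro AE_I2 tendsto_intros \<phi>)
    qed (auto simp: I_def)
    moreover have "(LINT x|lborel. W x * \<phi> n x) = 0" for n
    proof -
      have out: "\<phi> n x = 0" if "x \<notin> {a<..<b}" for x
        using \<phi>(4)[of x n] that by (auto simp: I_def)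
      then have "(\<lambda>x. W x * \<phi> n x) = (\<lambda>x. w x * \<phi> n x)"
        using out by (force simp: W_def indicator_def fun_eq_iff)
      then show ?thesis using zero[OF \<phi>(1) out] by simp
    qed
    ultimately have "(LINT x|lborel. W x * indicator I x) = 0"
      by (simp add: LIMSEQ_const_iff)
    also have "(\<lambda>x. W x * indicator I x) = (\<lambda>x. indicator {c<..<d} x *\<^sub>R W x)"
      by (auto simp: W_def I_def indicator_def)
    finally show "(LINT x:{c<..<d}|lborel. W x) = 0"
      unfolding set_lebesgue_integral_def .
  qed
  then show ?thesis
    by (rule AE_mp) (auto simp: W_def)
qed

lemma AE_if_AE_on_intervals:
  assumes "\<And>n::nat. AE x in lborel. x \<in> {- real (Suc n)<..<real (Suc n)} \<longrightarrow> P x"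
  shows "AE x::real in lborel. P x"
proof -
  have "AE x in lborel. \<forall>n. x \<in> {- real (Suc n)<..<real (Suc n)} \<longrightarrow> P x"
    by (subst AE_all_countable) (rule allI, rule assms)
  then show ?thesis
  proof (rule AE_mp, intro AE_I2 impI)
    fix x :: real
    assume *: "\<forall>n. x \<in> {- real (Suc n)<..<real (Suc n)} \<longrightarrow> P x"
    obtain N where "\<bar>x\<bar> < real N" using reals_Archimedean2 by blast
    then have "x \<in> {- real (Suc N)<..<real (Suc N)}" by auto
    with * show "P x" by blast
  qed
qed

lemma AE_zero_if_test_integrals_zero:
  assumes "locally_integrable w"
    and "\<And>\<phi>. test_function \<phi> \<Longrightarrow> (LINT x|lborel. w x * \<phi> x) = 0"
  shows "AE x in lborel. w x = 0"
proof (rule AE_if_AE_on_intervals)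
  fix n
  show "AE x in lborel. x \<in> {- real (Suc n)<..<real (Suc n)} \<longrightarrow> w x = 0"
    by (rule AE_zero_on_Ioo_if_test_integrals_zero)
       (use assms in \<open>simp_all add: locally_integrable_def del: of_nat_Suc\<close>)
qed

lemma has_weak_deriv_unique:
  assumes "has_weak_deriv n g h" "has_weak_deriv n g h'"
  shows "AE x in lborel. h x = h' x"
proof -
  have loc: "locally_integrable h" "locally_integrable h'"
    using assms unfolding has_weak_deriv_def by auto
  have "AE x in lborel. h x - h' x = 0"
  proof (rule AE_zero_if_test_integrals_zero)
    show "locally_integrable (\<lambda>x. h x - h' x)"
      using loc by (rule locally_integrable_diff)
    fix \<phi> assume \<phi>: "test_function \<phi>"
    have "(- 1) ^ n * (LINT x|lborel. h x * \<phi> x) = (- 1) ^ n * (LINT x|lborel. h' x * \<phi> x)"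
      using assms[unfolded has_weak_deriv_def, THEN conjunct2, THEN conjunct2, rule_format, OF \<phi>]
      by simp
    then show "(LINT x|lborel. (h x - h' x) * \<phi> x) = 0"
      using loc[THEN test_function_integrable_mult[OF \<phi>]] by (simp add: left_diff_distrib)
  qed
  then show ?thesis by simp
qed

lemma weak_deriv_has_weak_deriv:
  "has_weak_deriv n g h \<Longrightarrow> has_weak_deriv n g (weak_deriv n g)"
  unfolding weak_deriv_def by (rule someI[where P = "has_weak_deriv n g"])

text \<open>Frees the Sobolev norm from the choice operator: any known weak derivative may stand in
  for the selected one.\<close>

lemma L2_norm_weak_deriv:
  assumes "has_weak_deriv n g h"
  shows "L2_norm (weak_deriv n g) = L2_norm h"
proof -
  have w: "has_weak_deriv n g (weak_deriv n g)"
    by (rule weak_deriv_has_weak_deriv[OF assms])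
  have [measurable]: "h \<in> borel_measurable borel" "weak_deriv n g \<in> borel_measurable borel"
    using assms w locally_integrable_measurable unfolding has_weak_deriv_def by auto
  have "AE x in lborel. (weak_deriv n g x)\<^sup>2 = (h x)\<^sup>2"
    using has_weak_deriv_unique[OF w assms] by (rule AE_mp) simp
  then have "(LINT x|lborel. (weak_deriv n g x)\<^sup>2) = (LINT x|lborel. (h x)\<^sup>2)"
    by (intro integral_cong_AE) auto
  then show ?thesis
    unfolding L2_norm_def by simp
qed

lemma has_weak_deriv_0: "locally_integrable g \<Longrightarrow> has_weak_deriv 0 g g"
  unfolding has_weak_deriv_def by simp

lemma has_weak_deriv_diff:
  assumes "has_weak_deriv n g h" "has_weak_deriv n g' h'"
  shows "has_weak_deriv n (\<lambda>x. g x - g' x) (\<lambda>x. h x - h' x)"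
  using assms test_function_integrable_mult[OF test_function_deriv_funpow]
    test_function_integrable_mult
  unfolding has_weak_deriv_def
  by (auto intro!: locally_integrable_diff simp: left_diff_distrib right_diff_distrib)

section \<open>The Sobolev embedding\<close>

lemma test_function_integral_atLeast:
  assumes "test_function \<phi>"
  shows "(LINT x|lborel. (if y \<le> x then deriv \<phi> x else 0)) = - \<phi> y"
proof -
  obtain L where L: "L > 0" "\<And>x. L < \<bar>x\<bar> \<Longrightarrow> \<phi> x = 0"
    using test_function_support[OF assms] by metis
  obtain L' where L': "L' > 0" "\<And>x. L' < \<bar>x\<bar> \<Longrightarrow> deriv \<phi> x = 0"
    using test_function_support[OF test_function_deriv[OF assms]] by metis
  \<comment> \<open>Beyond \<open>y\<close> and the supports of both \<open>\<phi>\<close> and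
    \<open>deriv \<phi>\<close>, so the half line can be cut at \<open>M\<close> and
    \<open>\<phi> M = 0\<close>.\<close>
  define M where "M = L + L' + \<bar>y\<bar>"
  have "(LINT x|lborel. deriv \<phi> x * indicator {y..M} x) = \<phi> M - \<phi> y"
    using L L' test_function_continuous[OF test_function_deriv[OF assms], of UNIV]
    by (intro integral_FTC_Icc_real test_function_DERIV assms)
       (auto simp: M_def continuous_on_eq_continuous_at)
  also have "(\<lambda>x. deriv \<phi> x * indicator {y..M} x) = (\<lambda>x. if y \<le> x then deriv \<phi> x else 0)"
  proof
    fix x
    show "deriv \<phi> x * indicator {y..M} x = (if y \<le> x then deriv \<phi> x else 0)"
      using L(1) L'(2)[of x] by (cases "L' < \<bar>x\<bar>") (auto simp: M_def indicator_def)
  qed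
  also have "\<phi> M = 0"
    using L L' by (intro L) (simp add: M_def)
  finally show ?thesis by simp
qed

lemma primitive_measurable:
  fixes H :: "real \<Rightarrow> real"
  assumes [measurable]: "H \<in> borel_measurable borel"
  shows "(\<lambda>x. LINT y|lborel. (if y \<le> x then H y else 0)) \<in> borel_measurable borel"
  by measurable

lemma primitive_bounded:
  fixes H :: "real \<Rightarrow> real"
  assumes "integrable lborel H"
  shows "\<bar>LINT y|lborel. (if y \<le> x then H y else 0)\<bar> \<le> (LINT y|lborel. \<bar>H y\<bar>)"
proof -
  have "\<bar>LINT y|lborel. (if y \<le> x then H y else 0)\<bar> \<le> (LINT y|lborel. \<bar>if y \<le> x then H y else 0\<bar>)"
    by (rule integral_abs_bound)
  also have "\<dots> \<le> (LINT y|lborel. \<bar>H y\<bar>)"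
    by (rule Bochner_Integration.integral_mono')
       (use assms in auto)
  finally show ?thesis .
qed

text \<open>Fubini on the half plane y <= x: for fixed y the integral of \<open>deriv \<phi>\<close>
  from y to infinity is \<open>- \<phi> y\<close>, without boundary term at infinity by compact
  support.\<close>

lemma primitive_integration_by_parts:
  fixes H :: "real \<Rightarrow> real"
  assumes H: "integrable lborel H" and \<phi>: "test_function \<phi>"
  shows "(LINT x|lborel. (LINT y|lborel. (if y \<le> x then H y else 0)) * deriv \<phi> x)
       = - (LINT y|lborel. H y * \<phi> y)"
proof -
  have \<phi>': "test_function (deriv \<phi>)" by (rule test_function_deriv[OF \<phi>])
  have [measurable]: "deriv \<phi> \<in> borel_measurable borel" "H \<in> borel_measurable borel"
    using test_function_measurable[OF \<phi>'] H by auto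
  define k where "k x y = (if y \<le> x then H y * deriv \<phi> x else 0)" for x y
  have prod: "integrable (lborel \<Otimes>\<^sub>M lborel) (\<lambda>(x, y). deriv \<phi> x * H y)"
    by (rule lborel_pair.Fubini_integrable)
       (use H test_function_integrable[OF \<phi>'] in \<open>auto simp: abs_mult\<close>)
  have k: "integrable (lborel \<Otimes>\<^sub>M lborel) (case_prod k)"
  proof (rule Bochner_Integration.integrable_bound[OF prod])
    show "case_prod k \<in> borel_measurable (lborel \<Otimes>\<^sub>M lborel)"
      unfolding k_def by measurable
  qed (auto simp: k_def abs_mult intro!: AE_I2)
  have "(LINT x|lborel. (LINT y|lborel. (if y \<le> x then H y else 0)) * deriv \<phi> x)
      = (LINT x|lborel. (LINT y|lborel. k x y))"
    by (simp add: k_def if_distrib[where f = "\<lambda>t. t * _"] flip: integral_mult_left_zero cong: if_cong)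
  also have "\<dots> = (LINT y|lborel. (LINT x|lborel. k x y))"
    by (rule lborel_pair.Fubini_integral[OF k, symmetric])
  also have "\<dots> = (LINT y|lborel. - (H y * \<phi> y))"
  proof (intro Bochner_Integration.integral_cong refl)
    fix y
    have "(LINT x|lborel. k x y) = (LINT x|lborel. H y * (if y \<le> x then deriv \<phi> x else 0))"
      by (intro Bochner_Integration.integral_cong) (auto simp: k_def)
    also have "\<dots> = - (H y * \<phi> y)"
      by (simp add: test_function_integral_atLeast[OF \<phi>])
    finally show "(LINT x|lborel. k x y) = - (H y * \<phi> y)" .
  qed
  finally show ?thesis by simp
qed

text \<open>Subtracting the primitive reduces this to the lemma of du Bois-Reymond: a function
  with vanishing weak derivative is orthogonal to all test functions of zero mean.\<close>

lemma weak_deriv_primitive: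
  assumes wd: "has_weak_deriv 1 v h" and R: "R > 0"
  obtains c where "AE x in lborel. x \<in> {-R<..<R} \<longrightarrow>
    v x = c + (LINT y|lborel. (if y \<le> x then indicator {-R..R} y * h y else 0))"
proof -
  \<comment> \<open>\<open>h\<close> is only known to be locally integrable, so its primitive is
    formed after truncation; test functions supported in [-R, R] do not see the difference.\<close>
  define H where "H y = indicator {-R..R} y * h y" for y
  define V where "V x = (LINT y|lborel. (if y \<le> x then H y else 0))" for x
  have loc: "locally_integrable v" "locally_integrable h"
    using wd unfolding has_weak_deriv_def by auto
  have H: "integrable lborel H"
    using loc(2) unfolding locally_integrable_def set_integrable_def H_def by simp
  have locV: "locally_integrable V"
  proof (rule locally_integrable_bounded)
    show "V \<in> borel_measurable borel"
      unfolding V_def using H by (intro primitive_measurable) auto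
    show "\<bar>V x\<bar> \<le> (LINT y|lborel. \<bar>H y\<bar>)" for x
      unfolding V_def by (rule primitive_bounded[OF H])
  qed
  define G where "G x = v x - V x" for x
  have locG: "locally_integrable G"
    unfolding G_def by (intro locally_integrable_diff loc locV)
  have G0: "(LINT x|lborel. G x * deriv \<phi> x) = 0"
    if \<phi>: "test_function \<phi>" and supp: "\<And>x. x \<notin> {-R..R} \<Longrightarrow> \<phi> x = 0" for \<phi>
  proof -
    have "(LINT x|lborel. v x * deriv \<phi> x) = - (LINT x|lborel. h x * \<phi> x)"
      using wd \<phi> unfolding has_weak_deriv_def by simp
    moreover have "(LINT x|lborel. V x * deriv \<phi> x) = - (LINT x|lborel. H x * \<phi> x)"
      unfolding V_def by (rule primitive_integration_by_parts[OF H \<phi>])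
    moreover have "(\<lambda>x. H x * \<phi> x) = (\<lambda>x. h x * \<phi> x)"
      using supp by (auto simp: H_def indicator_def fun_eq_iff)
    ultimately show ?thesis
      using test_function_integrable_mult[OF test_function_deriv[OF \<phi>] loc(1)]
        test_function_integrable_mult[OF test_function_deriv[OF \<phi>] locV]
      by (simp add: G_def left_diff_distrib)
  qed
  \<comment> \<open>A reference bump with nonzero mean; multiples of it remove the mean of any other
    test function.\<close>
  obtain \<eta> where \<eta>: "test_function \<eta>" "\<And>x. x \<notin> {-R<..<R} \<Longrightarrow> \<eta> x = 0" "(LINT x|lborel. \<eta> x) \<noteq> 0"
  proof -
    obtain \<phi> where \<phi>: "\<And>n. test_function (\<phi> n)" "\<And>n x. 0 \<le> \<phi> n x" "\<And>n x. \<phi> n x \<le> 1"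
      "\<And>n x. x \<notin> {-R<..<R} \<Longrightarrow> \<phi> n x = 0" "\<And>x. (\<lambda>n::nat. \<phi> n x) \<longlonglongrightarrow> indicator {-R<..<R} x"
      by (rule indicator_Ioo_test_approx[of "-R" R]) blast
    have [measurable]: "\<phi> n \<in> borel_measurable borel" for n
      by (rule test_function_measurable[OF \<phi>(1)])
    have "(\<lambda>n. LINT x|lborel. \<phi> n x) \<longlonglongrightarrow> (LINT x|lborel. indicator {-R<..<R} x)"
    proof (rule integral_dominated_convergence)
      show "integrable lborel (indicator {-R..R} :: real \<Rightarrow> real)"
        by (rule integrable_indicator_Icc)
      have "\<bar>\<phi> n x\<bar> \<le> indicator {-R..R} x" for n x
        using \<phi>(2)[of n x] \<phi>(3)[of n x] \<phi>(4)[of x n] by (auto simp: indicator_def)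
      then show "AE x in lborel. norm (\<phi> n x) \<le> indicator {-R..R} x" for n by simp
    qed (use \<phi>(5) in auto)
    also have "(LINT x|lborel. indicator {-R<..<R} x :: real) = 2 * R"
      using R by simp
    finally have "\<forall>\<^sub>F n in sequentially. 0 < (LINT x|lborel. \<phi> n x)"
      by (rule order_tendstoD(1)) (use R in simp)
    then obtain n where "(LINT x|lborel. \<phi> n x) > 0"
      using eventually_sequentially by auto
    then show thesis using \<phi> by (intro that[of "\<phi> n"]) auto
  qed
  \<comment> \<open>The constant for which \<open>G - c\<close> is orthogonal to
    \<open>\<eta>\<close>.\<close>
  define c where "c = (LINT x|lborel. G x * \<eta> x) / (LINT x|lborel. \<eta> x)"
  have "AE x in lborel. x \<in> {-R<..<R} \<longrightarrow> G x - c = 0"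
  proof (rule AE_zero_on_Ioo_if_test_integrals_zero)
    show "set_integrable lborel {-R..R} (\<lambda>x. G x - c)"
      using locally_integrable_diff[OF locG locally_integrable_const]
      unfolding locally_integrable_def by blast
    fix \<rho> assume \<rho>: "test_function \<rho>" and supp: "\<And>x. x \<notin> {-R<..<R} \<Longrightarrow> \<rho> x = 0"
    \<comment> \<open>With this multiple of \<open>\<eta>\<close> removed, \<open>\<sigma>\<close>
      has mean 0; it is then the derivative of a test function supported in the window, hence
      orthogonal to \<open>G\<close> by \<open>G0\<close>.\<close>
    define a where "a = (LINT x|lborel. \<rho> x) / (LINT x|lborel. \<eta> x)"
    define \<sigma> where "\<sigma> x = \<rho> x - a * \<eta> x" for x
    note a\<eta> = test_function_mult_const[OF \<eta>(1), of a]
    have \<sigma>: "test_function \<sigma>"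
      unfolding \<sigma>_def by (rule test_function_diff[OF \<rho> a\<eta>])
    have "(LINT x|lborel. \<sigma> x) = (LINT x|lborel. \<rho> x) - a * (LINT x|lborel. \<eta> x)"
      unfolding \<sigma>_def using test_function_integrable[OF \<rho>] test_function_integrable[OF \<eta>(1)] by simp
    then have z: "(LINT x|lborel. \<sigma> x) = 0"
      using \<eta>(3) by (simp add: a_def)
    have s: "\<sigma> x = 0" if "x \<notin> {-R..R}" for x
      using that supp[of x] \<eta>(2)[of x] by (auto simp: \<sigma>_def)
    obtain \<phi> where "test_function \<phi>" "deriv \<phi> = \<sigma>" "\<And>x. x \<notin> {-R..R} \<Longrightarrow> \<phi> x = 0"
      by (rule test_function_primitive[OF \<sigma> _ s z]) (use R in auto)
    then have "(LINT x|lborel. G x * \<sigma> x) = 0"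
      using G0 by blast
    moreover have "(LINT x|lborel. G x * \<sigma> x) = (LINT x|lborel. G x * \<rho> x) - a * (LINT x|lborel. G x * \<eta> x)"
    proof -
      have "(\<lambda>x. G x * \<sigma> x) = (\<lambda>x. G x * \<rho> x - a * (G x * \<eta> x))"
        by (auto simp: \<sigma>_def algebra_simps)
      then show ?thesis
        using test_function_integrable_mult[OF \<rho> locG] test_function_integrable_mult[OF \<eta>(1) locG]
        by simp
    qed
    moreover have "a * (LINT x|lborel. G x * \<eta> x) = c * (LINT x|lborel. \<rho> x)"
      by (simp add: a_def c_def)
    ultimately show "(LINT x|lborel. (G x - c) * \<rho> x) = 0"
      using test_function_integrable_mult[OF \<rho> locG] test_function_integrable[OF \<rho>]
      by (simp add: left_diff_distrib)
  qed
  then have "AE x in lborel. x \<in> {-R<..<R} \<longrightarrow> v x = c + V x"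
    by (rule AE_mp) (auto simp: G_def)
  then show thesis
    using that[of c] unfolding V_def H_def by simp
qed

text \<open>On a window \<open>v\<close> agrees a.e. with \<open>c + V\<close>, whose increments
  over distances at most 1 are bounded by \<open>L2_norm h\<close>. Comparing a point with all
  points of an adjacent unit interval and averaging squares gives a bound independent of the
  window.\<close>

lemma H1_bounded:
  assumes v: "v \<in> L2" and h: "h \<in> L2" and wd: "has_weak_deriv 1 v h"
  shows "AE x in lborel. (v x)\<^sup>2 \<le> 2 * ((L2_norm v)\<^sup>2 + (L2_norm h)\<^sup>2)"
proof (rule AE_if_AE_on_intervals)
  fix n
  define R where "R = real (Suc n)"
  have R: "R \<ge> 1" by (simp add: R_def)
  define V where "V x = (LINT y|lborel. (if y \<le> x then indicator {-R..R} y * h y else 0))" for x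
  obtain c where c: "AE x in lborel. x \<in> {-R<..<R} \<longrightarrow> v x = c + V x"
    unfolding V_def by (rule weak_deriv_primitive[OF wd]) (use R in auto)
  have H: "integrable lborel (\<lambda>y. indicator {-R..R} y * h y)"
    by (rule L2_integrable_mult[OF L2_indicator h])
  have inc: "(V y - V z)\<^sup>2 \<le> (L2_norm h)\<^sup>2" if "z \<le> y" "y \<le> z + 1" for y z
  proof -
    \<comment> \<open>The increment of \<open>V\<close> pairs \<open>h\<close> with the indicator of
      a set inside an interval of length at most 1, so Cauchy-Schwarz costs a factor of at most
      1.\<close>
    define J where "J x = (if z < x \<and> x \<le> y \<and> x \<in> {-R..R} then 1 else 0 :: real)" for x
    have [measurable]: "J \<in> borel_measurable borel"
      unfolding J_def by measurable
    have J: "J \<in> L2"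
      by (rule L2I_bound[where k = "indicator {z..y}"])
         (auto simp: J_def indicator_def integrable_indicator_Icc)
    have "(L2_norm J)\<^sup>2 \<le> (LINT x|lborel. indicator {z..y} x)"
      unfolding L2_norm_power2
    proof (rule integral_mono)
      show "integrable lborel (\<lambda>x. (J x)\<^sup>2)" by (rule L2_integrable_square[OF J])
      show "integrable lborel (\<lambda>x. indicator {z..y} x :: real)" by (rule integrable_indicator_Icc)
      show "(J x)\<^sup>2 \<le> indicator {z..y} x" for x
        by (simp add: J_def indicator_def)
    qed
    also have "\<dots> \<le> 1\<^sup>2" using that by simp
    finally have J1: "L2_norm J \<le> 1"
      by (rule power2_le_imp_le) simp
    have int: "integrable lborel (\<lambda>y. if y \<le> x then indicator {-R..R} y * h y else 0)" for x
      by (rule Bochner_Integration.integrable_bound[OF H]) (use h in \<open>auto intro!: AE_I2\<close>)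
    have "V y - V z = (LINT x|lborel. (if x \<le> y then indicator {-R..R} x * h x else 0)
       - (if x \<le> z then indicator {-R..R} x * h x else 0))"
      unfolding V_def using int by simp
    also have "\<dots> = (LINT x|lborel. J x * h x)"
      using that by (intro Bochner_Integration.integral_cong) (auto simp: J_def indicator_def)
    finally have "\<bar>V y - V z\<bar> \<le> L2_norm J * L2_norm h"
      using L2_Cauchy_Schwarz[OF J h] by simp
    also have "\<dots> \<le> L2_norm h"
      using J1 by (intro mult_left_le_one_le) auto
    finally have "\<bar>V y - V z\<bar>\<^sup>2 \<le> (L2_norm h)\<^sup>2"
      by (rule power_mono) simp
    then show ?thesis by simp
  qed
  have main: "(c + V x)\<^sup>2 \<le> 2 * ((L2_norm v)\<^sup>2 + (L2_norm h)\<^sup>2)" if x: "x \<in> {-R<..<R}" for x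
  proof -
    \<comment> \<open>The unit interval runs left from \<open>x\<close> if x >= 0 and right
      otherwise, so it stays inside (-R, R) because R >= 1.\<close>
    define a where "a = (if 0 \<le> x then x - 1 else x)"
    have near: "(c + V x)\<^sup>2 \<le> 2 * (c + V z)\<^sup>2 + 2 * (L2_norm h)\<^sup>2" if z: "z \<in> {a<..<a + 1}" for z
    proof -
      have "(V x - V z)\<^sup>2 \<le> (L2_norm h)\<^sup>2"
        using inc[of z x] inc[of x z] z by (auto simp: a_def power2_commute split: if_splits)
      then show ?thesis
        using square_add_le[of "c + V z" "V x - V z"] by (simp add: algebra_simps)
    qed
    have sub: "{a<..<a + 1} \<subseteq> {-R<..<R}"
      using x R by (auto simp: a_def)
    have "(c + V x)\<^sup>2 = (LINT z|lborel. (c + V x)\<^sup>2 * indicator {a<..<a + 1} z)"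
      by simp
    also have "\<dots> \<le> (LINT z|lborel. 2 * (v z)\<^sup>2 + 2 * (L2_norm h)\<^sup>2 * indicator {a<..<a + 1} z)"
    proof (rule integral_mono_AE)
      show "AE z in lborel. (c + V x)\<^sup>2 * indicator {a<..<a + 1} z
          \<le> 2 * (v z)\<^sup>2 + 2 * (L2_norm h)\<^sup>2 * indicator {a<..<a + 1} z"
        using c
      proof (rule AE_mp, intro AE_I2 impI)
        fix z assume "z \<in> {-R<..<R} \<longrightarrow> v z = c + V z"
        then show "(c + V x)\<^sup>2 * indicator {a<..<a + 1} z
          \<le> 2 * (v z)\<^sup>2 + 2 * (L2_norm h)\<^sup>2 * indicator {a<..<a + 1} z"
          using near[of z] sub by (cases "z \<in> {a<..<a + 1}") auto
      qed
    qed (use L2_integrable_square[OF v] in simp_all)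
    also have "\<dots> = 2 * ((L2_norm v)\<^sup>2 + (L2_norm h)\<^sup>2)"
      using L2_integrable_square[OF v] by (simp add: L2_norm_power2)
    finally show ?thesis .
  qed
  show "AE x in lborel. x \<in> {- real (Suc n)<..<real (Suc n)} \<longrightarrow>
      (v x)\<^sup>2 \<le> 2 * ((L2_norm v)\<^sup>2 + (L2_norm h)\<^sup>2)"
    using c unfolding R_def[symmetric]
    by (rule AE_mp) (use main in \<open>auto intro!: AE_I2\<close>)
qed

section \<open>The nonlinearity\<close>

text \<open>A local Lipschitz condition adapted to L2 on the line: the right-hand side is a product
  of two factors that are square integrable along the solution, and b = 0 gives |F a| <= C a^2,
  which is integrable without any decay beyond L2.\<close>

definition quadratic_lipschitz :: "(real \<Rightarrow> real) \<Rightarrow> bool" where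
  "quadratic_lipschitz F \<longleftrightarrow> F \<in> borel_measurable borel \<and> F 0 = 0 \<and>
     (\<forall>M. \<exists>C\<ge>0. \<forall>a b. \<bar>a\<bar> \<le> M \<longrightarrow> \<bar>b\<bar> \<le> M \<longrightarrow> \<bar>F a - F b\<bar> \<le> C * (\<bar>a\<bar> + \<bar>b\<bar>) * \<bar>a - b\<bar>)"

lemma quadratic_lipschitz_power2: "quadratic_lipschitz (\<lambda>s. s\<^sup>2)"
  unfolding quadratic_lipschitz_def
proof (intro conjI allI exI[of _ 1] impI)
  fix a b :: real
  have "a\<^sup>2 - b\<^sup>2 = (a + b) * (a - b)"
    by (simp add: power2_eq_square algebra_simps)
  then show "\<bar>a\<^sup>2 - b\<^sup>2\<bar> \<le> 1 * (\<bar>a\<bar> + \<bar>b\<bar>) * \<bar>a - b\<bar>"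
    by (simp add: abs_mult mult_right_mono abs_triangle_ineq)
qed auto

lemma quadratic_lipschitz_abs:
  assumes "quadratic_lipschitz F"
  shows "quadratic_lipschitz (\<lambda>s. \<bar>F s\<bar>)"
proof -
  have le: "\<bar>\<bar>F a\<bar> - \<bar>F b\<bar>\<bar> \<le> c" if "\<bar>F a - F b\<bar> \<le> c" for a b c
    using that by simp
  have [measurable]: "F \<in> borel_measurable borel"
    using assms unfolding quadratic_lipschitz_def by blast
  show ?thesis
    using assms unfolding quadratic_lipschitz_def
    by (intro conjI allI) (measurable, simp, meson le)
qed

lemma bounded_on_interval:
  fixes g :: "real \<Rightarrow> real"
  assumes "continuous_on UNIV g"
  obtains C where "C \<ge> 0" "\<And>x. \<bar>x\<bar> \<le> M \<Longrightarrow> \<bar>g x\<bar> \<le> C"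
proof -
  have "compact (g ` {-M..M})"
    by (rule compact_continuous_image[OF continuous_on_subset[OF assms]]) auto
  then obtain C where C: "\<And>x. x \<in> {-M..M} \<Longrightarrow> \<bar>g x\<bar> \<le> C"
    by (fastforce simp: bounded_iff dest!: compact_imp_bounded)
  show thesis
  proof (rule that[of "\<bar>C\<bar>"])
    show "\<bar>g x\<bar> \<le> \<bar>C\<bar>" if "\<bar>x\<bar> \<le> M" for x
      using C[of x] that by (auto simp: abs_le_iff)
  qed simp
qed

text \<open>The mean value theorem twice: f'(0) = 0 gives |f'(s)| <= C |s|, and then f a - f b is,
  up to sign, |a - b| times f' at a point of modulus at most |a| + |b|.\<close>

lemma quadratic_lipschitz_if_critical_zero:
  fixes f f' f'' :: "real \<Rightarrow> real"
  assumes f: "\<And>x. (f has_real_derivative f' x) (at x)"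
    and f': "\<And>x. (f' has_real_derivative f'' x) (at x)"
    and cont: "continuous_on UNIV f''" and zero: "f 0 = 0" "f' 0 = 0"
  shows "quadratic_lipschitz f"
  unfolding quadratic_lipschitz_def
proof (intro conjI allI)
  show "f \<in> borel_measurable borel"
    by (intro borel_measurable_continuous_onI continuous_at_imp_continuous_on ballI DERIV_isCont[OF f])
  fix M
  obtain C where C: "C \<ge> 0" "\<And>x. \<bar>x\<bar> \<le> M \<Longrightarrow> \<bar>f'' x\<bar> \<le> C"
    by (rule bounded_on_interval[OF cont]) blast
  have mvt: "\<exists>z. \<bar>z\<bar> \<le> max \<bar>a\<bar> \<bar>b\<bar> \<and> \<bar>g a - g b\<bar> = \<bar>a - b\<bar> * \<bar>g' z\<bar>"
    if g: "\<And>x. (g has_real_derivative g' x) (at x)" for g g' :: "real \<Rightarrow> real" and a b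
  proof -
    consider "a < b" | "b < a" | "a = b" by linarith
    then show ?thesis
    proof cases
      case 1
      then obtain z where "a < z" "z < b" "g b - g a = (b - a) * g' z"
        using MVT2[OF 1, of g g'] g by blast
      then show ?thesis
        by (intro exI[of _ z]) (auto simp: abs_mult abs_minus_commute[of "g a"] abs_minus_commute[of a])
    next
      case 2
      then obtain z where "b < z" "z < a" "g a - g b = (a - b) * g' z"
        using MVT2[OF 2, of g g'] g by blast
      then show ?thesis
        by (intro exI[of _ z]) (auto simp: abs_mult)
    qed (auto intro: exI[of _ a])
  qed
  have lin: "\<bar>f' s\<bar> \<le> C * \<bar>s\<bar>" if s: "\<bar>s\<bar> \<le> M" for s
  proof -
    obtain z where "\<bar>z\<bar> \<le> max \<bar>s\<bar> \<bar>0\<bar>" "\<bar>f' s - f' 0\<bar> = \<bar>s - 0\<bar> * \<bar>f'' z\<bar>"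
      using mvt[of f' f'' s 0] f' by blast
    then show ?thesis
      using C(2)[of z] s by (simp add: zero mult.commute[of C] mult_left_mono)
  qed
  have "\<bar>f a - f b\<bar> \<le> C * (\<bar>a\<bar> + \<bar>b\<bar>) * \<bar>a - b\<bar>" if "\<bar>a\<bar> \<le> M" "\<bar>b\<bar> \<le> M" for a b
  proof -
    obtain z where z: "\<bar>z\<bar> \<le> max \<bar>a\<bar> \<bar>b\<bar>" "\<bar>f a - f b\<bar> = \<bar>a - b\<bar> * \<bar>f' z\<bar>"
      using mvt[of f f' a b] f by blast
    have "\<bar>f' z\<bar> \<le> C * \<bar>z\<bar>" by (rule lin) (use z that in linarith)
    also have "\<dots> \<le> C * (\<bar>a\<bar> + \<bar>b\<bar>)"
      using z(1) by (intro mult_left_mono C) linarith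
    finally show ?thesis
      unfolding z(2) by (subst mult.commute) (rule mult_right_mono, auto)
  qed
  then show "\<exists>C\<ge>0. \<forall>a b. \<bar>a\<bar> \<le> M \<longrightarrow> \<bar>b\<bar> \<le> M \<longrightarrow> \<bar>f a - f b\<bar> \<le> C * (\<bar>a\<bar> + \<bar>b\<bar>) * \<bar>a - b\<bar>"
    using C(1) by blast
qed (rule zero)

text \<open>Since k >= 2, \<open>g\<close> has a continuous second derivative, and being o(|s|^k)
  forces both its value and its slope at 0 to vanish.\<close>

lemma admissible_quadratic_lipschitz:
  assumes "admissible_nonlinearity f"
  shows "quadratic_lipschitz f"
proof -
  obtain k g where k: "k \<ge> 2" and g: "C_class k g" and lim: "((\<lambda>s. g s / \<bar>s\<bar> ^ k) \<longlongrightarrow> 0) (at 0)"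
    and f: "\<And>s. f s = s ^ k + g s"
    using assms unfolding admissible_nonlinearity_def by blast
  have diff: "(deriv ^^ j) g differentiable (at x)" if "j < k" for j x
    using g that unfolding C_class_def by blast
  have D0: "(g has_real_derivative deriv g x) (at x)"
    and D1: "(deriv g has_real_derivative deriv (deriv g) x) (at x)" for x
    using diff[of 0 x] diff[of 1 x] k by (simp_all add: DERIV_deriv_iff_real_differentiable)
  have D2: "continuous_on UNIV (deriv (deriv g))"
  proof -
    have "continuous_on UNIV ((deriv ^^ 2) g)"
    proof (cases "k = 2")
      case False
      then have "(deriv ^^ 2) g differentiable (at x)" for x
        using diff k by simp
      then show ?thesis
        by (intro continuous_at_imp_continuous_on ballI differentiable_imp_continuous_within)
    qed (use g C_class_def in blast)
    then show ?thesis by (simp add: numeral_2_eq_2)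
  qed
  \<comment> \<open>Away from 0 these products are g(s) for \<open>j = k\<close> and g(s)/s up to
    sign for \<open>j = k - 1\<close>; the two cases give the value and the slope at 0.\<close>
  have bound: "((\<lambda>s. g s / \<bar>s\<bar> ^ k * \<bar>s\<bar> ^ j) \<longlongrightarrow> 0) (at 0)" for j
  proof -
    have "((\<lambda>s. g s / \<bar>s\<bar> ^ k * \<bar>s\<bar> ^ j) \<longlongrightarrow> 0 * \<bar>0\<bar> ^ j) (at 0)"
      by (intro tendsto_intros lim)
    then show ?thesis by simp
  qed
  have "(g \<longlongrightarrow> g 0) (at 0)"
    using DERIV_isCont[OF D0] by (simp add: isCont_def)
  moreover have "(g \<longlongrightarrow> 0) (at 0)"
    by (rule Lim_transform_eventually[OF bound[of k]])
       (auto simp: eventually_at intro!: exI[of _ 1])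
  ultimately have g0: "g 0 = 0"
    using LIM_unique by blast
  have "((\<lambda>h. (g (0 + h) - g 0) / h) \<longlongrightarrow> 0) (at 0)"
  proof (rule Lim_null_comparison)
    show "((\<lambda>s. \<bar>g s / \<bar>s\<bar> ^ k * \<bar>s\<bar> ^ (k - 1)\<bar>) \<longlongrightarrow> 0) (at 0)"
      using tendsto_rabs[OF bound] by simp
    have "\<bar>s\<bar> ^ k = \<bar>s\<bar> * \<bar>s\<bar> ^ (k - 1)" for s :: real
      using k by (cases k) auto
    then have "norm ((g (0 + s) - g 0) / s) \<le> \<bar>g s / \<bar>s\<bar> ^ k * \<bar>s\<bar> ^ (k - 1)\<bar>" if "s \<noteq> 0" for s
      using that by (simp add: g0 abs_mult)
    then show "\<forall>\<^sub>F s in at 0. norm ((g (0 + s) - g 0) / s) \<le> \<bar>g s / \<bar>s\<bar> ^ k * \<bar>s\<bar> ^ (k - 1)\<bar>"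
      by (auto simp: eventually_at intro!: exI[of _ 1])
  qed
  then have g'0: "deriv g 0 = 0"
    by (intro DERIV_imp_deriv) (simp add: DERIV_def)
  show ?thesis
  proof (rule quadratic_lipschitz_if_critical_zero)
    show "(f has_real_derivative real k * x ^ (k - 1) + deriv g x) (at x)" for x
      unfolding f[abs_def] by (auto intro!: derivative_eq_intros D0)
    show "((\<lambda>x. real k * x ^ (k - 1) + deriv g x) has_real_derivative
        real k * (real (k - 1) * x ^ (k - 1 - 1)) + deriv (deriv g) x) (at x)" for x
      by (auto intro!: derivative_eq_intros D1)
    show "continuous_on UNIV (\<lambda>x. real k * (real (k - 1) * x ^ (k - 1 - 1)) + deriv (deriv g) x)"
      by (intro continuous_intros D2)
    show "f 0 = 0" "real k * 0 ^ (k - 1) + deriv g 0 = 0"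
      using k by (auto simp: f g0 g'0)
  qed
qed

section \<open>Continuous curves in the weighted Sobolev space\<close>

lemma L2_norm_le_weighted_sobolev_norm:
  assumes "has_weak_deriv j g h" "j \<le> m"
  shows "L2_norm h \<le> weighted_sobolev_norm m r g"
proof -
  have "(L2_norm h)\<^sup>2 = (L2_norm (weak_deriv j g))\<^sup>2"
    using L2_norm_weak_deriv[OF assms(1)] by simp
  also have "\<dots> \<le> (\<Sum>j\<le>m. (L2_norm (weak_deriv j g))\<^sup>2)"
    using assms(2) by (intro member_le_sum) auto
  also have "\<dots> \<le> (\<Sum>j\<le>m. (L2_norm (weak_deriv j g))\<^sup>2) + (LINT x|lborel. (g x)\<^sup>2 * \<bar>x\<bar> powr (2 * r))"
    by simp
  finally show ?thesis
    unfolding weighted_sobolev_norm_def by (rule real_le_rsqrt)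
qed

locale sobolev_curve =
  fixes u :: "real \<Rightarrow> real \<Rightarrow> real" and m :: nat and r :: real
  assumes cont: "continuous_in_weighted_sobolev m r u" and m: "1 \<le> m"
begin

lemma u_L2: "u t \<in> L2"
  using cont unfolding continuous_in_weighted_sobolev_def weighted_sobolev_def sobolev_def by blast

lemma u_measurable [measurable]: "u t \<in> borel_measurable borel"
  by (rule L2_measurable[OF u_L2])

lemma u_weak_deriv:
  assumes "j \<le> m"
  obtains h where "h \<in> L2" "has_weak_deriv j (u t) h"
  using cont assms unfolding continuous_in_weighted_sobolev_def weighted_sobolev_def sobolev_def
  by blast

lemma norm_diff_tendsto:
  "((\<lambda>s. weighted_sobolev_norm m r (\<lambda>x. u s x - u t x)) \<longlongrightarrow> 0) (at t)"
  using cont unfolding continuous_in_weighted_sobolev_def by blast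

lemma L2_norm_diff_tendsto: "((\<lambda>s. L2_norm (\<lambda>x. u s x - u t x)) \<longlongrightarrow> 0) (at t)"
proof (rule Lim_null_comparison[OF _ norm_diff_tendsto[of t]])
  have "has_weak_deriv 0 (\<lambda>x. u s x - u t x) (\<lambda>x. u s x - u t x)" for s
    by (intro has_weak_deriv_0 L2_locally_integrable L2_diff u_L2)
  then show "\<forall>\<^sub>F s in at t. norm (L2_norm (\<lambda>x. u s x - u t x))
      \<le> weighted_sobolev_norm m r (\<lambda>x. u s x - u t x)"
    by (intro always_eventually allI) (simp add: L2_norm_le_weighted_sobolev_norm[where j = 0])
qed

text \<open>One \<open>M\<close> has to serve all times near \<open>t\<close>, since the constant in
  \<open>quadratic_lipschitz\<close> depends on it.\<close>

lemma locally_bounded: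
  obtains M where "AE x in lborel. \<bar>u t x\<bar> \<le> M"
    "\<forall>\<^sub>F s in at t. AE x in lborel. \<bar>u s x\<bar> \<le> M"
proof -
  obtain h where h: "h \<in> L2" "has_weak_deriv 1 (u t) h"
    using u_weak_deriv[OF m] by blast
  define B where "B = sqrt (2 * ((L2_norm (u t))\<^sup>2 + (L2_norm h)\<^sup>2))"
  have B: "AE x in lborel. \<bar>u t x\<bar> \<le> B"
    using H1_bounded[OF u_L2 h] unfolding B_def
    by (rule AE_mp) (intro AE_I2 impI real_le_rsqrt, simp only: power2_abs)
  have "\<forall>\<^sub>F s in at t. weighted_sobolev_norm m r (\<lambda>x. u s x - u t x) < 1"
    by (rule order_tendstoD(2)[OF norm_diff_tendsto]) simp
  \<comment> \<open>The 2 comes from the embedding applied to the difference: it and its derivative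
    have L2 norm at most 1, so its square is at most 2 (1 + 1) = 2^2.\<close>
  then have "\<forall>\<^sub>F s in at t. AE x in lborel. \<bar>u s x\<bar> \<le> B + 2"
  proof (rule eventually_mono)
    fix s assume less: "weighted_sobolev_norm m r (\<lambda>x. u s x - u t x) < 1"
    obtain h' where h': "h' \<in> L2" "has_weak_deriv 1 (u s) h'"
      using u_weak_deriv[OF m] by blast
    let ?d = "\<lambda>x. u s x - u t x" and ?e = "\<lambda>x. h' x - h x"
    have d: "?d \<in> L2" "?e \<in> L2" "has_weak_deriv 1 ?d ?e"
      using h h' u_L2 by (auto intro: L2_diff has_weak_deriv_diff)
    have 1: "L2_norm ?d \<le> 1" "L2_norm ?e \<le> 1"
      using L2_norm_le_weighted_sobolev_norm[OF has_weak_deriv_0[OF L2_locally_integrable[OF d(1)]], of m r]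
        L2_norm_le_weighted_sobolev_norm[OF d(3) m, of r] less
      by simp_all
    have "(L2_norm ?d)\<^sup>2 \<le> 1" "(L2_norm ?e)\<^sup>2 \<le> 1"
      by (rule power_le_one[OF L2_norm_nonneg 1(1)], rule power_le_one[OF L2_norm_nonneg 1(2)])
    then have "2 * ((L2_norm ?d)\<^sup>2 + (L2_norm ?e)\<^sup>2) \<le> 2\<^sup>2" by simp
    then have le: "y \<le> 2\<^sup>2" if "y \<le> 2 * ((L2_norm ?d)\<^sup>2 + (L2_norm ?e)\<^sup>2)" for y
      using that by linarith
    from H1_bounded[OF d] have "AE x in lborel. (?d x)\<^sup>2 \<le> 2\<^sup>2"
      by (rule AE_mp) (intro AE_I2 impI, rule le)
    then have "AE x in lborel. \<bar>?d x\<bar> \<le> 2"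
    proof eventually_elim
      case (elim x)
      then show ?case using abs_le_square_iff[of "u s x - u t x" 2] by simp
    qed
    with B show "AE x in lborel. \<bar>u s x\<bar> \<le> B + 2"
    proof eventually_elim
      case (elim x)
      then show ?case by linarith
    qed
  qed
  moreover have "AE x in lborel. \<bar>u t x\<bar> \<le> B + 2"
    using B by eventually_elim simp
  ultimately show thesis using that by blast
qed

lemma nonlinear_integrable:
  assumes F: "quadratic_lipschitz F" and [measurable]: "\<theta> \<in> borel_measurable borel"
    and K: "\<And>x. \<bar>\<theta> x\<bar> \<le> K"
  shows "integrable lborel (\<lambda>x. F (u t x) * \<theta> x)"
proof -
  have [measurable]: "F \<in> borel_measurable borel" and F0: "F 0 = 0"
    using F unfolding quadratic_lipschitz_def by blast+
  have K0: "K \<ge> 0" using K[of 0] by linarith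
  obtain M where M: "AE x in lborel. \<bar>u t x\<bar> \<le> M"
    using locally_bounded by blast
  \<comment> \<open>Makes 0 an admissible second argument of the Lipschitz estimate.\<close>
  define M' where "M' = max M 0"
  obtain C where C: "C \<ge> 0" "\<And>a b. \<bar>a\<bar> \<le> M' \<Longrightarrow> \<bar>b\<bar> \<le> M' \<Longrightarrow> \<bar>F a - F b\<bar> \<le> C * (\<bar>a\<bar> + \<bar>b\<bar>) * \<bar>a - b\<bar>"
    using F unfolding quadratic_lipschitz_def by blast
  show ?thesis
  proof (rule Bochner_Integration.integrable_bound)
    show "integrable lborel (\<lambda>x. K * (C * (u t x)\<^sup>2))"
      using L2_integrable_square[OF u_L2] by simp
    show "AE x in lborel. norm (F (u t x) * \<theta> x) \<le> norm (K * (C * (u t x)\<^sup>2))"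
      using M
    proof (rule AE_mp, intro AE_I2 impI)
      fix x assume "\<bar>u t x\<bar> \<le> M"
      then have "\<bar>F (u t x)\<bar> \<le> C * (u t x)\<^sup>2"
        using C(2)[of "u t x" 0] by (simp add: M'_def F0 power2_eq_square mult.assoc)
      then have "\<bar>\<theta> x\<bar> * \<bar>F (u t x)\<bar> \<le> K * (C * (u t x)\<^sup>2)"
        by (intro mult_mono K K0) auto
      also have "K * (C * (u t x)\<^sup>2) \<le> norm (K * (C * (u t x)\<^sup>2))"
        by simp
      finally show "norm (F (u t x) * \<theta> x) \<le> norm (K * (C * (u t x)\<^sup>2))"
        by (simp only: real_norm_def abs_mult mult.commute[of "\<bar>\<theta> x\<bar>"])
    qed
    show "(\<lambda>x. F (u t x) * \<theta> x) \<in> borel_measurable lborel"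
      by measurable
  qed
qed

text \<open>The change is at most K C times the integral of (|u s| + |u t|) |u s - u t|;
  Cauchy-Schwarz leaves a bounded factor times one that tends to 0.\<close>

lemma nonlinear_isCont:
  assumes F: "quadratic_lipschitz F" and [measurable]: "\<theta> \<in> borel_measurable borel"
    and K: "\<And>x. \<bar>\<theta> x\<bar> \<le> K"
  shows "isCont (\<lambda>t. LINT x|lborel. F (u t x) * \<theta> x) t"
proof -
  have K0: "K \<ge> 0" using K[of 0] by linarith
  note int = nonlinear_integrable[OF F assms(2) K]
  obtain M where M: "AE x in lborel. \<bar>u t x\<bar> \<le> M" "\<forall>\<^sub>F s in at t. AE x in lborel. \<bar>u s x\<bar> \<le> M"
    using locally_bounded by blast
  obtain C where C: "C \<ge> 0" "\<And>a b. \<bar>a\<bar> \<le> M \<Longrightarrow> \<bar>b\<bar> \<le> M \<Longrightarrow> \<bar>F a - F b\<bar> \<le> C * (\<bar>a\<bar> + \<bar>b\<bar>) * \<bar>a - b\<bar>"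
    using F unfolding quadratic_lipschitz_def by blast
  define A where "A = (L2_norm (u t))\<^sup>2"
  define d where "d s = L2_norm (\<lambda>x. u s x - u t x)" for s
  have d: "(d \<longlongrightarrow> 0) (at t)"
    unfolding d_def by (rule L2_norm_diff_tendsto)
  have "((\<lambda>s. (LINT x|lborel. F (u s x) * \<theta> x) - (LINT x|lborel. F (u t x) * \<theta> x)) \<longlongrightarrow> 0) (at t)"
  proof (rule Lim_null_comparison)
    \<comment> \<open>The root bounds the L2 norm of |u s| + |u t|: its square is at most 2 (u s)^2
      + 2 (u t)^2, and (u s)^2 <= 2 (u s - u t)^2 + 2 (u t)^2 produces the 6 and the 4.\<close>
    have "((\<lambda>s. K * (C * (sqrt (6 * A + 4 * (d s)\<^sup>2) * d s))) \<longlongrightarrow> K * (C * (sqrt (6 * A + 4 * 0\<^sup>2) * 0))) (at t)"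
      by (intro tendsto_intros d)
    then show "((\<lambda>s. K * (C * (sqrt (6 * A + 4 * (d s)\<^sup>2) * d s))) \<longlongrightarrow> 0) (at t)" by simp
    show "\<forall>\<^sub>F s in at t. norm ((LINT x|lborel. F (u s x) * \<theta> x) - (LINT x|lborel. F (u t x) * \<theta> x))
       \<le> K * (C * (sqrt (6 * A + 4 * (d s)\<^sup>2) * d s))"
      using M(2)
    proof (rule eventually_mono)
      fix s assume Ms: "AE x in lborel. \<bar>u s x\<bar> \<le> M"
      define p where "p x = \<bar>u s x\<bar> + \<bar>u t x\<bar>" for x
      define q where "q x = \<bar>u s x - u t x\<bar>" for x
      have p: "p \<in> L2" unfolding p_def by (intro L2_add L2_abs u_L2)
      have q: "q \<in> L2" unfolding q_def by (intro L2_abs L2_diff u_L2)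
      have dq: "L2_norm q = d s" by (simp add: L2_norm_def q_def d_def)
      have "(L2_norm p)\<^sup>2 \<le> (LINT x|lborel. 6 * (u t x)\<^sup>2 + 4 * (q x)\<^sup>2)"
        unfolding L2_norm_power2
      proof (rule integral_mono)
        fix x
        have "(p x)\<^sup>2 \<le> 2 * (u s x)\<^sup>2 + 2 * (u t x)\<^sup>2"
          unfolding p_def using square_add_le[of "\<bar>u s x\<bar>" "\<bar>u t x\<bar>"] by simp
        also have "(u s x)\<^sup>2 \<le> 2 * (u s x - u t x)\<^sup>2 + 2 * (u t x)\<^sup>2"
          using square_add_le[of "u s x - u t x" "u t x"] by simp
        finally show "(p x)\<^sup>2 \<le> 6 * (u t x)\<^sup>2 + 4 * (q x)\<^sup>2"
          by (simp add: q_def)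
      qed (use L2_integrable_square[OF p] L2_integrable_square[OF q] L2_integrable_square[OF u_L2] in simp_all)
      also have "\<dots> = 6 * A + 4 * (d s)\<^sup>2"
        using L2_integrable_square[OF q] L2_integrable_square[OF u_L2]
        by (simp add: A_def L2_norm_power2 flip: dq)
      finally have np: "L2_norm p \<le> sqrt (6 * A + 4 * (d s)\<^sup>2)"
        by (rule real_le_rsqrt)
      have "\<bar>(LINT x|lborel. F (u s x) * \<theta> x) - (LINT x|lborel. F (u t x) * \<theta> x)\<bar>
          = \<bar>LINT x|lborel. F (u s x) * \<theta> x - F (u t x) * \<theta> x\<bar>"
        using int by simp
      also have "\<dots> \<le> (LINT x|lborel. \<bar>F (u s x) * \<theta> x - F (u t x) * \<theta> x\<bar>)"
        by (rule integral_abs_bound)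
      also have "\<dots> \<le> (LINT x|lborel. K * (C * (p x * q x)))"
      proof (rule integral_mono_AE)
        show "AE x in lborel. \<bar>F (u s x) * \<theta> x - F (u t x) * \<theta> x\<bar> \<le> K * (C * (p x * q x))"
        proof (rule AE_mp[OF AE_conjI[OF Ms M(1)]], intro AE_I2 impI)
          fix x assume "\<bar>u s x\<bar> \<le> M \<and> \<bar>u t x\<bar> \<le> M"
          then have "\<bar>F (u s x) - F (u t x)\<bar> \<le> C * (p x * q x)"
            using C(2) by (simp add: p_def q_def mult.assoc)
          then have "\<bar>\<theta> x\<bar> * \<bar>F (u s x) - F (u t x)\<bar> \<le> K * (C * (p x * q x))"
            by (intro mult_mono K K0) auto
          then show "\<bar>F (u s x) * \<theta> x - F (u t x) * \<theta> x\<bar> \<le> K * (C * (p x * q x))"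
            by (simp add: abs_mult[symmetric] algebra_simps)
        qed
      qed (use int L2_integrable_mult[OF p q] in simp_all)
      also have "\<dots> = K * (C * (LINT x|lborel. p x * q x))" by simp
      also have "\<dots> \<le> K * (C * (L2_norm p * L2_norm q))"
        using L2_Cauchy_Schwarz[OF p q] by (intro mult_left_mono K0 C) simp
      also have "\<dots> \<le> K * (C * (sqrt (6 * A + 4 * (d s)\<^sup>2) * d s))"
        using np unfolding dq by (intro mult_left_mono mult_right_mono K0 C) (simp_all add: d_def)
      finally show "norm ((LINT x|lborel. F (u s x) * \<theta> x) - (LINT x|lborel. F (u t x) * \<theta> x))
       \<le> K * (C * (sqrt (6 * A + 4 * (d s)\<^sup>2) * d s))" by simp
    qed
  qed
  then show ?thesis
    unfolding isCont_def by (rule LIM_zero_cancel)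
qed

lemma linear_isCont:
  assumes \<theta>: "\<theta> \<in> L2"
  shows "isCont (\<lambda>t. LINT x|lborel. u t x * \<theta> x) t"
proof -
  have "((\<lambda>s. (LINT x|lborel. u s x * \<theta> x) - (LINT x|lborel. u t x * \<theta> x)) \<longlongrightarrow> 0) (at t)"
  proof (rule Lim_null_comparison)
    show "((\<lambda>s. L2_norm (\<lambda>x. u s x - u t x) * L2_norm \<theta>) \<longlongrightarrow> 0) (at t)"
      by (rule tendsto_mult_left_zero[OF L2_norm_diff_tendsto])
    have "norm ((LINT x|lborel. u s x * \<theta> x) - (LINT x|lborel. u t x * \<theta> x))
        \<le> L2_norm (\<lambda>x. u s x - u t x) * L2_norm \<theta>" for s
    proof -
      have "(LINT x|lborel. u s x * \<theta> x) - (LINT x|lborel. u t x * \<theta> x) = (LINT x|lborel. (u s x - u t x) * \<theta> x)"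
        using L2_integrable_mult[OF u_L2 \<theta>] by (simp add: left_diff_distrib)
      then show ?thesis
        using L2_Cauchy_Schwarz[OF L2_diff[OF u_L2 u_L2] \<theta>] by simp
    qed
    then show "\<forall>\<^sub>F s in at t. norm ((LINT x|lborel. u s x * \<theta> x) - (LINT x|lborel. u t x * \<theta> x))
        \<le> L2_norm (\<lambda>x. u s x - u t x) * L2_norm \<theta>"
      by simp
  qed
  then show ?thesis
    unfolding isCont_def by (rule LIM_zero_cancel)
qed

end

section \<open>Testing the equation\<close>

lemma test_function_L2: "test_function \<phi> \<Longrightarrow> \<phi> \<in> L2"
proof -
  assume \<phi>: "test_function \<phi>"
  obtain K where "\<And>x. \<bar>\<phi> x\<bar> \<le> K"
    using test_function_bounded[OF \<phi>] by blast
  then have "locally_integrable \<phi>"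
    by (rule locally_integrable_bounded[OF test_function_measurable[OF \<phi>]])
  then show ?thesis
    using test_function_integrable_mult[OF \<phi>] test_function_measurable[OF \<phi>]
    unfolding L2_def by (simp add: power2_eq_square)
qed

lemma L2_time_deriv_DERIV:
  assumes "has_L2_time_deriv u v t" and \<phi>: "\<phi> \<in> L2"
  shows "((\<lambda>s. LINT x|lborel. u s x * \<phi> x) has_real_derivative (LINT x|lborel. v x * \<phi> x)) (at t)"
proof -
  have v: "v \<in> L2" and u: "\<And>s. u s \<in> L2"
    and lim: "((\<lambda>h. L2_norm (\<lambda>x. (u (t + h) x - u t x) / h - v x)) \<longlongrightarrow> 0) (at 0)"
    using assms(1) unfolding has_L2_time_deriv_def by blast+
  have "((\<lambda>h. ((LINT x|lborel. u (t + h) x * \<phi> x) - (LINT x|lborel. u t x * \<phi> x)) / h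
      - (LINT x|lborel. v x * \<phi> x)) \<longlongrightarrow> 0) (at 0)"
  proof (rule Lim_null_comparison)
    show "((\<lambda>h. L2_norm (\<lambda>x. (u (t + h) x - u t x) / h - v x) * L2_norm \<phi>) \<longlongrightarrow> 0) (at 0)"
      by (rule tendsto_mult_left_zero[OF lim])
    \<comment> \<open>No case split at \<open>h = 0\<close>: division by 0 yields 0 on both
      sides.\<close>
    have "norm (((LINT x|lborel. u (t + h) x * \<phi> x) - (LINT x|lborel. u t x * \<phi> x)) / h
        - (LINT x|lborel. v x * \<phi> x)) \<le> L2_norm (\<lambda>x. (u (t + h) x - u t x) / h - v x) * L2_norm \<phi>" for h
    proof -
      have q: "(\<lambda>x. (u (t + h) x - u t x) / h - v x) \<in> L2"
        using L2_diff[OF L2_scale[OF L2_diff[OF u u], of "1 / h"] v] by simp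
      note int = L2_integrable_mult[OF u \<phi>] L2_integrable_mult[OF v \<phi>]
      have "((LINT x|lborel. u (t + h) x * \<phi> x) - (LINT x|lborel. u t x * \<phi> x)) / h
          - (LINT x|lborel. v x * \<phi> x)
        = (LINT x|lborel. (u (t + h) x * \<phi> x - u t x * \<phi> x) / h - v x * \<phi> x)"
        using int by simp
      also have "(\<lambda>x. (u (t + h) x * \<phi> x - u t x * \<phi> x) / h - v x * \<phi> x)
        = (\<lambda>x. ((u (t + h) x - u t x) / h - v x) * \<phi> x)"
        by (auto simp: left_diff_distrib diff_divide_distrib)
      finally show ?thesis
        using L2_Cauchy_Schwarz[OF q \<phi>] by simp
    qed
    then show "\<forall>\<^sub>F h in at 0. norm (((LINT x|lborel. u (t + h) x * \<phi> x) - (LINT x|lborel. u t x * \<phi> x)) / h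
        - (LINT x|lborel. v x * \<phi> x)) \<le> L2_norm (\<lambda>x. (u (t + h) x - u t x) / h - v x) * L2_norm \<phi>"
      by simp
  qed
  then show ?thesis
    unfolding DERIV_def by (rule LIM_zero_cancel)
qed

locale gKdV_solution =
  fixes u :: "real \<Rightarrow> real \<Rightarrow> real" and f :: "real \<Rightarrow> real" and m :: nat and r :: real
  assumes sol: "strong_solution_gKdV m r f u" and m2: "2 \<le> m" and f: "quadratic_lipschitz f"
begin

sublocale sobolev_curve u m r
  using sol m2 unfolding strong_solution_gKdV_def by unfold_locales auto

lemma f_u_integrable: "integrable lborel (\<lambda>x. f (u t x))"
  using nonlinear_integrable[OF f, of "\<lambda>_. 1" 1] by simp

text \<open>The weak derivative in the equation moves one derivative onto \<open>\<phi>\<close>, its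
  sign cancelling the minus in v = -w; the weak second derivative of \<open>u t\<close> moves two
  more, with sign +1.\<close>

lemma testing_DERIV:
  assumes \<phi>: "test_function \<phi>"
  shows "((\<lambda>s. LINT x|lborel. u s x * \<phi> x) has_real_derivative
    (LINT x|lborel. u t x * (deriv ^^ 3) \<phi> x) + (LINT x|lborel. f (u t x) * deriv \<phi> x)) (at t)"
proof -
  obtain v w where v: "has_L2_time_deriv u v t"
    and w: "has_weak_deriv 1 (\<lambda>x. weak_deriv 2 (u t) x + f (u t x)) w"
    and vw: "AE x in lborel. v x + w x = 0"
    using sol unfolding strong_solution_gKdV_def by blast
  obtain h where "has_weak_deriv 2 (u t) h"
    using u_weak_deriv[OF m2] by blast
  then have wd2: "has_weak_deriv 2 (u t) (weak_deriv 2 (u t))"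
    by (rule weak_deriv_has_weak_deriv)
  have \<phi>': "test_function (deriv \<phi>)" by (rule test_function_deriv[OF \<phi>])
  have loc: "locally_integrable v" "locally_integrable w" "locally_integrable (weak_deriv 2 (u t))"
    using v w wd2 L2_locally_integrable unfolding has_L2_time_deriv_def has_weak_deriv_def by blast+
  note [measurable] = loc[THEN locally_integrable_measurable] test_function_measurable[OF \<phi>]
  obtain K where K: "\<And>x. \<bar>deriv \<phi> x\<bar> \<le> K"
    using test_function_bounded[OF \<phi>'] by blast
  have fint: "integrable lborel (\<lambda>x. f (u t x) * deriv \<phi> x)"
    by (rule nonlinear_integrable[OF f test_function_measurable[OF \<phi>'] K])
  have "(LINT x|lborel. v x * \<phi> x) = (LINT x|lborel. - (w x * \<phi> x))"
  proof (rule integral_cong_AE)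
    show "AE x in lborel. v x * \<phi> x = - (w x * \<phi> x)"
      using vw
    proof eventually_elim
      case (elim x)
      then have "v x = - w x" by linarith
      then show ?case by simp
    qed
  qed measurable
  also have "\<dots> = (LINT x|lborel. (weak_deriv 2 (u t) x + f (u t x)) * (deriv ^^ 1) \<phi> x)"
    using w \<phi> unfolding has_weak_deriv_def by simp
  also have "\<dots> = (LINT x|lborel. weak_deriv 2 (u t) x * deriv \<phi> x) + (LINT x|lborel. f (u t x) * deriv \<phi> x)"
    using test_function_integrable_mult[OF \<phi>' loc(3)] fint by (simp add: distrib_right)
  also have "(LINT x|lborel. weak_deriv 2 (u t) x * deriv \<phi> x) = (LINT x|lborel. u t x * (deriv ^^ 2) (deriv \<phi>) x)"
    using wd2 \<phi>' unfolding has_weak_deriv_def by simp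
  also have "(deriv ^^ 2) (deriv \<phi>) = (deriv ^^ 3) \<phi>"
    by (simp add: numeral_3_eq_3 numeral_2_eq_2)
  finally show ?thesis
    using L2_time_deriv_DERIV[OF v test_function_L2[OF \<phi>]] by simp
qed

lemma tested_period_integral:
  assumes \<omega>: "\<omega> > 0" and per: "time_periodic \<omega> u" and \<phi>: "test_function \<phi>"
  shows "(LINT t:{0..\<omega>}|lborel. (LINT x|lborel. u t x * (deriv ^^ 3) \<phi> x) + (LINT x|lborel. f (u t x) * deriv \<phi> x)) = 0"
proof -
  have \<phi>': "test_function (deriv \<phi>)" by (rule test_function_deriv[OF \<phi>])
  obtain K where K: "\<And>x. \<bar>deriv \<phi> x\<bar> \<le> K"
    using test_function_bounded[OF \<phi>'] by blast
  note [measurable] = test_function_measurable[OF \<phi>]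
  have "(LINT t|lborel. ((LINT x|lborel. u t x * (deriv ^^ 3) \<phi> x) + (LINT x|lborel. f (u t x) * deriv \<phi> x))
      * indicator {0..\<omega>} t) = (LINT x|lborel. u \<omega> x * \<phi> x) - (LINT x|lborel. u 0 x * \<phi> x)"
  proof (rule integral_FTC_Icc_real)
    \<comment> \<open>The fundamental theorem of calculus needs a continuous time derivative;
      continuity of the curve in the Sobolev norm supplies it.\<close>
    show "isCont (\<lambda>t. (LINT x|lborel. u t x * (deriv ^^ 3) \<phi> x) + (LINT x|lborel. f (u t x) * deriv \<phi> x)) t" for t
      by (intro isCont_add linear_isCont nonlinear_isCont[OF f test_function_measurable[OF \<phi>'] K]
          test_function_L2 test_function_deriv_funpow \<phi>)
  qed (use \<omega> testing_DERIV[OF \<phi>] in auto)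
  also have "(LINT x|lborel. u \<omega> x * \<phi> x) = (LINT x|lborel. u 0 x * \<phi> x)"
  proof (rule integral_cong_AE)
    have "AE x in lborel. u (0 + \<omega>) x = u 0 x"
      using per unfolding time_periodic_def by blast
    then show "AE x in lborel. u \<omega> x * \<phi> x = u 0 x * \<phi> x"
      by eventually_elim simp
  qed measurable
  finally show ?thesis
    unfolding set_lebesgue_integral_def by (simp add: mult.commute)
qed

lemma isCont_integral_f: "isCont (\<lambda>t. LINT x|lborel. f (u t x)) t"
proof -
  have "isCont (\<lambda>t. LINT x|lborel. f (u t x) * 1) t"
    by (rule nonlinear_isCont[OF f, where K = 1]) simp_all
  then show ?thesis by (simp only: mult_1_right)
qed

lemma continuous_on_integral_f: "continuous_on A (\<lambda>t. LINT x|lborel. f (u t x))"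
  by (intro continuous_at_imp_continuous_on ballI isCont_integral_f)

text \<open>The factor s^(-1/2) lost here is outweighed by the s^2 coming from the third
  derivative.\<close>

lemma L2_norm_test_function_scale:
  assumes "s > 0"
  shows "L2_norm (\<lambda>x. \<psi> (s * x)) = L2_norm \<psi> / sqrt s"
proof -
  have "(LINT x|lborel. (\<psi> x)\<^sup>2) = s * (LINT x|lborel. (\<psi> (s * x))\<^sup>2)"
    using lborel_integral_real_affine[of s "\<lambda>x. (\<psi> x)\<^sup>2" 0] assms by simp
  then show ?thesis
    using assms unfolding L2_norm_def by (simp add: real_sqrt_mult)
qed

lemma period_integral_zero:
  assumes \<omega>: "\<omega> > 0" and per: "time_periodic \<omega> u"
  shows "(LINT t:{0..\<omega>}|lborel. (LINT x|lborel. f (u t x))) = 0"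
proof -
  obtain \<psi> where \<psi>: "test_function \<psi>" and \<psi>0: "deriv \<psi> 0 \<noteq> 0"
    by (rule ex_test_function_deriv_nonzero)
  have \<psi>': "test_function (deriv \<psi>)" by (rule test_function_deriv[OF \<psi>])
  obtain K where K: "K > 0" "\<And>x. \<bar>deriv \<psi> x\<bar> \<le> K"
    by (rule test_function_bounded[OF \<psi>']) blast
  define \<psi>3 where "\<psi>3 = (deriv ^^ 3) \<psi>"
  have \<psi>3: "test_function \<psi>3"
    unfolding \<psi>3_def by (rule test_function_deriv_funpow[OF \<psi>])
  note [measurable] = test_function_measurable[OF \<psi>'] test_function_measurable[OF \<psi>3]
  define s where "s n = 1 / real (Suc n)" for n
  have s: "0 < s n" "s n \<le> 1" for n by (auto simp: s_def)
  have s_lim: "s \<longlonglongrightarrow> 0"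
    unfolding s_def[abs_def] by (rule LIMSEQ_Suc) (rule lim_const_over_n)
  \<comment> \<open>Testing with psi(s x) produces \<open>s n * (D n t + E n t)\<close>:
    \<open>D\<close> is the dispersive term, with s^2 left once the common factor is divided out,
    and \<open>E\<close> is the nonlinear one.\<close>
  define D where "D n t = (s n)\<^sup>2 * (LINT x|lborel. u t x * \<psi>3 (s n * x))" for n t
  define E where "E n t = (LINT x|lborel. f (u t x) * deriv \<psi> (s n * x))" for n t
  have test_s: "test_function (\<lambda>x. \<psi> (s n * x))" for n
    by (rule test_function_scale(1)[OF \<psi>]) (use s(1)[of n] in simp)
  have \<psi>3s_L2: "(\<lambda>x. \<psi>3 (s n * x)) \<in> L2" for n
    by (rule test_function_L2, rule test_function_scale(1)[OF \<psi>3]) (use s(1)[of n] in simp)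
  have zero: "(LINT t:{0..\<omega>}|lborel. D n t + E n t) = 0" for n
  proof -
    have sn: "s n \<noteq> 0" using s(1)[of n] by simp
    have d1: "deriv (\<lambda>x. \<psi> (s n * x)) = (\<lambda>x. s n * deriv \<psi> (s n * x))"
      using test_function_scale(2)[OF \<psi> sn, of 1] by simp
    have d3: "(deriv ^^ 3) (\<lambda>x. \<psi> (s n * x)) = (\<lambda>x. s n ^ 3 * \<psi>3 (s n * x))"
      unfolding \<psi>3_def by (rule test_function_scale(2)[OF \<psi> sn])
    have eq: "(LINT x|lborel. u t x * (s n ^ 3 * \<psi>3 (s n * x))) + (LINT x|lborel. f (u t x) * (s n * deriv \<psi> (s n * x)))
        = s n * (D n t + E n t)" for t
    proof -
      have "(\<lambda>x. u t x * (s n ^ 3 * \<psi>3 (s n * x))) = (\<lambda>x. s n ^ 3 * (u t x * \<psi>3 (s n * x)))"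
        "(\<lambda>x. f (u t x) * (s n * deriv \<psi> (s n * x))) = (\<lambda>x. s n * (f (u t x) * deriv \<psi> (s n * x)))"
        by (simp_all only: mult.left_commute)
      then show ?thesis
        by (simp only: integral_mult_right_zero D_def E_def distrib_left power2_eq_square power3_eq_cube mult.assoc)
    qed
    have "(LINT t:{0..\<omega>}|lborel. s n * (D n t + E n t)) = 0"
      using tested_period_integral[OF \<omega> per test_s, of n] unfolding d1 d3 eq .
    then show ?thesis using sn by simp
  qed
  have contE: "isCont (E n) t" for n t
    unfolding E_def by (intro nonlinear_isCont[OF f _ K(2)]) measurable
  have contD: "isCont (D n) t" for n t
    unfolding D_def by (intro isCont_mult[OF continuous_const] linear_isCont \<psi>3s_L2)
  have [measurable]: "E n \<in> borel_measurable borel" "D n \<in> borel_measurable borel" for n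
    by (intro borel_measurable_continuous_onI continuous_at_imp_continuous_on ballI contE contD)+
  have [measurable]: "(\<lambda>t. LINT x|lborel. f (u t x)) \<in> borel_measurable borel"
    by (intro borel_measurable_continuous_onI continuous_on_integral_f)
  \<comment> \<open>The order obtained from Cauchy-Schwarz is s^(3/2), relaxed to s by
    \<open>s n \<le> 1\<close>.\<close>
  have D_bound: "\<bar>D n t\<bar> \<le> s n * (L2_norm (u t) * L2_norm \<psi>3)" for n t
  proof -
    have "\<bar>LINT x|lborel. u t x * \<psi>3 (s n * x)\<bar> \<le> L2_norm (u t) * (L2_norm \<psi>3 / sqrt (s n))"
      using L2_Cauchy_Schwarz[OF u_L2 \<psi>3s_L2] L2_norm_test_function_scale[OF s(1)] by metis
    then have "\<bar>D n t\<bar> \<le> (s n)\<^sup>2 * (L2_norm (u t) * (L2_norm \<psi>3 / sqrt (s n)))"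
      unfolding D_def abs_mult abs_power2 by (intro mult_left_mono) auto
    also have "\<dots> = (s n * (s n / sqrt (s n))) * (L2_norm (u t) * L2_norm \<psi>3)"
      by (simp add: power2_eq_square)
    also have "s n / sqrt (s n) = sqrt (s n)"
      using s(1)[of n] by (simp add: real_div_sqrt)
    also have "s n * sqrt (s n) * (L2_norm (u t) * L2_norm \<psi>3) \<le> s n * 1 * (L2_norm (u t) * L2_norm \<psi>3)"
      using s(1)[of n] s(2)[of n] by (intro mult_right_mono mult_left_mono) auto
    finally show ?thesis by simp
  qed
  have fabs: "integrable lborel (\<lambda>x. \<bar>f (u t x)\<bar>)" for t
    using f_u_integrable by simp
  have [measurable]: "f \<in> borel_measurable borel"
    using f unfolding quadratic_lipschitz_def by blast
  have E_bound: "\<bar>E n t\<bar> \<le> K * (LINT x|lborel. \<bar>f (u t x)\<bar>)" for n t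
  proof -
    have "\<bar>E n t\<bar> \<le> (LINT x|lborel. \<bar>f (u t x) * deriv \<psi> (s n * x)\<bar>)"
      unfolding E_def by (rule integral_abs_bound)
    also have "\<dots> \<le> (LINT x|lborel. K * \<bar>f (u t x)\<bar>)"
    proof (rule integral_mono)
      show "\<bar>f (u t x) * deriv \<psi> (s n * x)\<bar> \<le> K * \<bar>f (u t x)\<bar>" for x
        using K(2)[of "s n * x"] by (simp add: abs_mult mult.commute[of K] mult_left_mono)
      show "integrable lborel (\<lambda>x. \<bar>f (u t x) * deriv \<psi> (s n * x)\<bar>)"
        by (intro integrable_abs nonlinear_integrable[OF f _ K(2)]) measurable
    qed (use fabs in simp)
    finally show ?thesis by simp
  qed
  have E_lim: "(\<lambda>n. E n t) \<longlonglongrightarrow> deriv \<psi> 0 * (LINT x|lborel. f (u t x))" for t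
  proof -
    have "(\<lambda>n. E n t) \<longlonglongrightarrow> (LINT x|lborel. f (u t x) * deriv \<psi> 0)"
      unfolding E_def
    proof (rule integral_dominated_convergence)
      show "integrable lborel (\<lambda>x. K * \<bar>f (u t x)\<bar>)" using fabs by simp
      have "norm (f (u t x) * deriv \<psi> (s n * x)) \<le> K * \<bar>f (u t x)\<bar>" for n x
        using K(2)[of "s n * x"] by (simp add: abs_mult mult.commute[of K] mult_left_mono)
      then show "AE x in lborel. norm (f (u t x) * deriv \<psi> (s n * x)) \<le> K * \<bar>f (u t x)\<bar>" for n
        by simp
      have "(\<lambda>n. deriv \<psi> (s n * x)) \<longlonglongrightarrow> deriv \<psi> 0" for x
      proof (rule isCont_tendsto_compose[where g = "deriv \<psi>"])
        show "isCont (deriv \<psi>) 0"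
          by (rule DERIV_isCont[OF test_function_DERIV[OF \<psi>']])
        show "(\<lambda>n. s n * x) \<longlonglongrightarrow> 0"
          by (rule tendsto_mult_left_zero[OF s_lim])
      qed
      then show "AE x in lborel. (\<lambda>n. f (u t x) * deriv \<psi> (s n * x)) \<longlonglongrightarrow> f (u t x) * deriv \<psi> 0"
        by (intro AE_I2 tendsto_intros)
    qed measurable
    then show ?thesis by (simp add: mult.commute)
  qed
  have D_lim: "(\<lambda>n. D n t) \<longlonglongrightarrow> 0" for t
  proof (rule Lim_null_comparison)
    show "(\<lambda>n. s n * (L2_norm (u t) * L2_norm \<psi>3)) \<longlonglongrightarrow> 0"
      by (rule tendsto_mult_left_zero[OF s_lim])
    show "\<forall>\<^sub>F n in sequentially. norm (D n t) \<le> s n * (L2_norm (u t) * L2_norm \<psi>3)"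
      using D_bound by simp
  qed
  \<comment> \<open>A majorant in time for both terms, independent of \<open>n\<close> because
    \<open>s n \<le> 1\<close>; continuity makes it integrable over the period.\<close>
  define b where "b t = L2_norm (u t) * L2_norm \<psi>3 + K * (LINT x|lborel. \<bar>f (u t x)\<bar>)" for t
  have "continuous_on {0..\<omega>} b"
  proof -
    \<comment> \<open>The squared norm is the nonlinear functional for F(s) = s^2 with weight 1, so
      \<open>nonlinear_isCont\<close> covers it; |f| is treated likewise.\<close>
    have "isCont (\<lambda>t. LINT x|lborel. (u t x)\<^sup>2 * 1) t" for t
      by (rule nonlinear_isCont[OF quadratic_lipschitz_power2, where K = 1]) simp_all
    then have "isCont (\<lambda>t. L2_norm (u t)) t" for t
      unfolding L2_norm_def mult_1_right by (rule continuous_real_sqrt)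
    moreover have "isCont (\<lambda>t. LINT x|lborel. \<bar>f (u t x)\<bar> * 1) t" for t
      by (rule nonlinear_isCont[OF quadratic_lipschitz_abs[OF f], where K = 1]) simp_all
    then have "isCont (\<lambda>t. LINT x|lborel. \<bar>f (u t x)\<bar>) t" for t
      by (simp only: mult_1_right)
    ultimately show ?thesis
      unfolding b_def by (intro continuous_at_imp_continuous_on ballI continuous_intros)
  qed
  then have "integrable lborel (\<lambda>t. indicator {0..\<omega>} t *\<^sub>R b t)"
    using borel_integrable_atLeastAtMost' unfolding set_integrable_def by blast
  then have "(\<lambda>n. LINT t|lborel. indicator {0..\<omega>} t *\<^sub>R (D n t + E n t))
    \<longlonglongrightarrow> (LINT t|lborel. indicator {0..\<omega>} t *\<^sub>R (0 + deriv \<psi> 0 * (LINT x|lborel. f (u t x))))"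
  proof (rule integral_dominated_convergence[rotated 2])
    show "AE t in lborel. (\<lambda>n. indicator {0..\<omega>} t *\<^sub>R (D n t + E n t))
       \<longlonglongrightarrow> indicator {0..\<omega>} t *\<^sub>R (0 + deriv \<psi> 0 * (LINT x|lborel. f (u t x)))"
      by (intro AE_I2 tendsto_intros D_lim E_lim)
    have "\<bar>D n t + E n t\<bar> \<le> b t" for n t
    proof -
      have "s n * (L2_norm (u t) * L2_norm \<psi>3) \<le> L2_norm (u t) * L2_norm \<psi>3"
        using s(1)[of n] s(2)[of n] by (intro mult_left_le_one_le) auto
      then show ?thesis
        using D_bound[of n t] E_bound[of n t] unfolding b_def by linarith
    qed
    then show "AE t in lborel. norm (indicator {0..\<omega>} t *\<^sub>R (D n t + E n t)) \<le> indicator {0..\<omega>} t *\<^sub>R b t" for n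
      by (intro AE_I2) (simp add: indicator_def)
  qed measurable
  then have "(LINT t|lborel. indicator {0..\<omega>} t *\<^sub>R (0 + deriv \<psi> 0 * (LINT x|lborel. f (u t x)))) = 0"
    using zero unfolding set_lebesgue_integral_def by (simp add: LIMSEQ_const_iff)
  also have "(\<lambda>t. indicator {0..\<omega>} t *\<^sub>R (0 + deriv \<psi> 0 * (LINT x|lborel. f (u t x))))
      = (\<lambda>t. deriv \<psi> 0 * (indicator {0..\<omega>} t *\<^sub>R (LINT x|lborel. f (u t x))))"
    by auto
  finally show ?thesis
    using \<psi>0 unfolding set_lebesgue_integral_def by simp
qed

section \<open>Positive nonlinearities\<close>

lemma not_time_periodic:
  assumes pos: "\<And>s. s \<noteq> 0 \<Longrightarrow> 0 < f s" and nz: "\<not> identically_zero u" and \<omega>: "\<omega> > 0"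
  shows "\<not> time_periodic \<omega> u"
proof
  assume per: "time_periodic \<omega> u"
  have f0: "f 0 = 0" and [measurable]: "f \<in> borel_measurable borel"
    using f unfolding quadratic_lipschitz_def by blast+
  have f_nonneg: "0 \<le> f s" for s
    using pos[of s] f0 by (cases "s = 0") auto
  \<comment> \<open>The gauge integral gives access to \<open>integral_eq_0_iff\<close>: a
    continuous nonnegative function with zero integral vanishes at every time of the period, with no
    exceptional times.\<close>
  have "integral {0..\<omega>} (\<lambda>t. LINT x|lborel. f (u t x)) = 0"
    using period_integral_zero[OF \<omega> per]
      set_borel_integral_eq_integral(2)[OF borel_integrable_atLeastAtMost'[OF continuous_on_integral_f]]
    by simp
  then have "\<forall>t\<in>{0..\<omega>}. (LINT x|lborel. f (u t x)) = 0"
    using \<omega> f_nonneg by (subst (asm) integral_eq_0_iff[OF continuous_on_integral_f]) auto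
  then have base: "AE x in lborel. u t x = 0" if "t \<in> {0..\<omega>}" for t
  proof -
    have "AE x in lborel. f (u t x) = 0"
      using that \<open>\<forall>t\<in>{0..\<omega>}. (LINT x|lborel. f (u t x)) = 0\<close> f_nonneg
      by (subst integral_nonneg_eq_0_iff_AE[symmetric]) (auto intro: f_u_integrable)
    then show ?thesis
    proof eventually_elim
      case (elim x)
      then show ?case using pos[of "u t x"] by fastforce
    qed
  qed
  \<comment> \<open>Each shift by \<open>\<omega>\<close> has its own null set in x; only finitely
    many are merged.\<close>
  have shift: "AE x in lborel. u (t + real n * \<omega>) x = u t x" for t n
  proof (induction n)
    case (Suc n)
    have "AE x in lborel. u (t + real n * \<omega> + \<omega>) x = u (t + real n * \<omega>) x"
      using per unfolding time_periodic_def by blast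
    with Suc show ?case
      by eventually_elim (simp add: algebra_simps)
  qed simp
  have "AE x in lborel. u t x = 0" for t
  proof -
    \<comment> \<open>Removing whole periods brings \<open>t\<close> into [0, \<omega>). As
      \<open>shift\<close> only moves forward, negative \<open>k\<close> is handled by shifting
      \<open>t\<close> up to \<open>q\<close>.\<close>
    define k where "k = \<lfloor>t / \<omega>\<rfloor>"
    define q where "q = t - of_int k * \<omega>"
    have "of_int k \<le> t / \<omega>" "t / \<omega> < of_int k + 1"
      unfolding k_def by linarith+
    then have "q \<in> {0..\<omega>}"
      using \<omega> by (simp add: q_def field_simps)
    then have q: "AE x in lborel. u q x = 0" by (rule base)
    show ?thesis
    proof (cases "k \<ge> 0")
      case True
      have "q + real (nat k) * \<omega> = t" using True by (simp add: q_def)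
      with shift[of q "nat k"] have "AE x in lborel. u t x = u q x" by simp
      with q show ?thesis by eventually_elim simp
    next
      case False
      have "t + real (nat (- k)) * \<omega> = q" using False by (simp add: q_def)
      with shift[of t "nat (- k)"] have "AE x in lborel. u q x = u t x" by simp
      with q show ?thesis by eventually_elim simp
    qed
  qed
  then show False
    using nz unfolding identically_zero_def by blast
qed

end

text \<open>Negative discriminant: the square is completed after multiplying by 4 \<epsilon>^2,
  which is positive because the hypothesis forces \<epsilon> > 0. The absolute value covers both
  signs of the cubic term.\<close>

lemma quadratic_factor_pos:
  fixes \<mu> \<epsilon> s :: real
  assumes "\<bar>\<mu>\<bar> < 2 * \<epsilon>"
  shows "0 < 1 + \<mu> * s + \<epsilon>\<^sup>2 * s\<^sup>2"
proof -
  have "\<bar>\<mu>\<bar>\<^sup>2 < (2 * \<epsilon>)\<^sup>2"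
    by (rule power_strict_mono[OF assms]) auto
  then have \<mu>: "\<mu>\<^sup>2 < 4 * \<epsilon>\<^sup>2" by (simp add: power_mult_distrib)
  have eq: "4 * \<epsilon>\<^sup>2 * (1 + \<mu> * s + \<epsilon>\<^sup>2 * s\<^sup>2) = (4 * \<epsilon>\<^sup>2 - \<mu>\<^sup>2) + (2 * \<epsilon>\<^sup>2 * s + \<mu>)\<^sup>2"
    by (simp add: power2_eq_square algebra_simps)
  have "0 < 4 * \<epsilon>\<^sup>2 * (1 + \<mu> * s + \<epsilon>\<^sup>2 * s\<^sup>2)"
    unfolding eq using \<mu> by (intro add_pos_nonneg) auto
  then show ?thesis
    using assms by (simp add: zero_less_mult_iff)
qed

theorem theorem1p1:
  fixes u :: "real \<Rightarrow> real \<Rightarrow> real" and f :: "real \<Rightarrow> real"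
  assumes "admissible_nonlinearity f"
    and "strong_solution_gKdV 4 2 f u"
    and "\<not> identically_zero u"
  shows "(\<forall>\<omega>>0. time_periodic \<omega> u \<longrightarrow>
            (\<forall>t\<in>{0..\<omega>}. integrable lborel (\<lambda>x. f (u t x))) \<and>
            set_integrable lborel {0..\<omega>} (\<lambda>t. LINT x|lborel. f (u t x)) \<and>
            (LINT t:{0..\<omega>}|lborel. (LINT x|lborel. f (u t x))) = 0) \<and>
         ((\<forall>s. f s = s ^ 2) \<or>
          (\<forall>s. f s = s ^ 4) \<or>
          (\<exists>\<mu> \<epsilon>. 0 \<le> \<mu> \<and> \<mu> < 2 * \<epsilon> \<and>
             ((\<forall>s. f s = s ^ 2 + \<mu> * s ^ 3 + \<epsilon>\<^sup>2 * s ^ 4) \<or>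
              (\<forall>s. f s = s ^ 2 - \<mu> * s ^ 3 + \<epsilon>\<^sup>2 * s ^ 4)))
          \<longrightarrow> \<not> (\<exists>\<omega>>0. time_periodic \<omega> u))"
proof (intro conjI impI)
  interpret gKdV_solution u f 4 2
    by unfold_locales (use assms admissible_quadratic_lipschitz in simp_all)
  \<comment> \<open>A divergent integral is 0 by default, so the two integrability claims give the
    vanishing of the double integral its content.\<close>
  show "\<forall>\<omega>>0. time_periodic \<omega> u \<longrightarrow>
            (\<forall>t\<in>{0..\<omega>}. integrable lborel (\<lambda>x. f (u t x))) \<and>
            set_integrable lborel {0..\<omega>} (\<lambda>t. LINT x|lborel. f (u t x)) \<and>
            (LINT t:{0..\<omega>}|lborel. (LINT x|lborel. f (u t x))) = 0"
    by (intro allI impI conjI ballI f_u_integrable period_integral_zero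
        borel_integrable_atLeastAtMost' continuous_on_integral_f)
  assume cases: "(\<forall>s. f s = s ^ 2) \<or>
          (\<forall>s. f s = s ^ 4) \<or>
          (\<exists>\<mu> \<epsilon>. 0 \<le> \<mu> \<and> \<mu> < 2 * \<epsilon> \<and>
             ((\<forall>s. f s = s ^ 2 + \<mu> * s ^ 3 + \<epsilon>\<^sup>2 * s ^ 4) \<or>
              (\<forall>s. f s = s ^ 2 - \<mu> * s ^ 3 + \<epsilon>\<^sup>2 * s ^ 4)))"
  have "0 < f s" if s: "s \<noteq> 0" for s
  proof -
    \<comment> \<open>\<open>\<nu>\<close> will be \<open>\<mu>\<close> or \<open>- \<mu>\<close>;
      factoring out s^2 settles both signs at once.\<close>
    have quartic: "0 < s ^ 2 + \<nu> * s ^ 3 + \<epsilon>\<^sup>2 * s ^ 4" if "\<bar>\<nu>\<bar> < 2 * \<epsilon>" for \<nu> \<epsilon>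
    proof -
      have "s ^ 2 + \<nu> * s ^ 3 + \<epsilon>\<^sup>2 * s ^ 4 = s\<^sup>2 * (1 + \<nu> * s + \<epsilon>\<^sup>2 * s\<^sup>2)"
        by (simp add: algebra_simps power2_eq_square power3_eq_cube power4_eq_xxxx)
      then show ?thesis
        using s quadratic_factor_pos[OF that, of s] by simp
    qed
    from cases show ?thesis
    proof (elim disjE exE conjE)
      fix \<mu> \<epsilon> :: real
      assume \<mu>: "0 \<le> \<mu>" "\<mu> < 2 * \<epsilon>" and "\<forall>s. f s = s ^ 2 + \<mu> * s ^ 3 + \<epsilon>\<^sup>2 * s ^ 4"
      then have "f s = s ^ 2 + \<mu> * s ^ 3 + \<epsilon>\<^sup>2 * s ^ 4" by blast
      then show ?thesis using quartic[of \<mu> \<epsilon>] \<mu> by simp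
    next
      fix \<mu> \<epsilon> :: real
      assume \<mu>: "0 \<le> \<mu>" "\<mu> < 2 * \<epsilon>" and "\<forall>s. f s = s ^ 2 - \<mu> * s ^ 3 + \<epsilon>\<^sup>2 * s ^ 4"
      then have "f s = s ^ 2 - \<mu> * s ^ 3 + \<epsilon>\<^sup>2 * s ^ 4" by blast
      then show ?thesis using quartic[of "- \<mu>" \<epsilon>] \<mu> by simp
    qed (use s in simp_all)
  qed
  then show "\<not> (\<exists>\<omega>>0. time_periodic \<omega> u)"
    using not_time_periodic[OF _ assms(3)] by blast
qed

end
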